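(* Let $k\ge 0$ be an integer and let $p$ be an odd prime. Then the set $\Sigma_{k,1,p}\subset \mathcal{M}_p$ of conjugacy classes of degree $p$ polynomials with a marked critical point, for which the marked critical point is strictly $(k,1)$-preperiodic, is an irreducible subset of $\mathcal{M}_p$ under the Zariski topology.
   Context: For a polynomial $g\in\mathbb{C}[z]$, $g^0=\mathrm{id}$ and $g^m=g\circ g^{m-1}$. For integers $k\ge 0$, $n\ge 1$, a point $x\in\mathbb{C}$ is strictly $(k,n)$-preperiodic under $g$ if $g^{k+n}(x)=g^k(x)$ and $g^{l+m}(x)\ne g^l(x)$ for all integers $0\le l\le k$, $1\le m\le n$ with $(l,m)\neq(k,n)$. Let $d>2$. $\mathcal{M}_d$ is the set of equivalence classes of pairs $(f,\alpha)$, where $f\in\mathbb{C}[z]$ has degree $d$ and $\alpha\in\mathbb{C}$ satisfies $f'(\alpha)=0$ (the marked critical point), and $(f,\alpha)\sim(g,\gamma)$ iff there is $h(z)=az+b$, $a\in\mathbb{C}\setminus\{0\}$, $b\in\mathbb{C}$, with $g=h\circ f\circ h^{-1}$ and $h(\alpha)=\gamma$. Its structure of $(d-1)$-dimensional affine variety is the following. Let $V=\{(\alpha_1,\dots,\alpha_{d-1},\beta)\in\mathbb{C}^d:\sum_{i=1}^{d-1}\alpha_i=0\}$. For a point of $V$ put $$f_{\bar\alpha,\beta}(z)=z^d+\sum_{i=2}^{d-1}(-1)^i\frac{d}{d-i}s_i(\bar\alpha)z^{d-i}-\alpha_1^d-\sum_{i=2}^{d-1}(-1)^i\frac{d}{d-i}s_i(\bar\alpha)\alpha_1^{d-i}+\beta,$$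 where $s_i(\bar\alpha)$ is the $i$-th elementary symmetric polynomial in $\alpha_1,\dots,\alpha_{d-1}$; this is the monic polynomial with critical points $\alpha_1,\dots,\alpha_{d-1}$ (with multiplicity) and $f(\alpha_1)=\beta$. The map $V\to\mathcal{M}_d$ sending a point to the class of $(f_{\bar\alpha,\beta},\alpha_1)$ is surjective, and its fibres are the orbits of the finite group $G\subset GL_d(\mathbb{C})$ generated by the permutation matrices fixing the first and last coordinates and by the scalar matrices $\zeta I$ with $\zeta^{d-1}=1$. Thus $\mathcal{M}_d$ is identified with the affine variety $V/G$; its Zariski topology is the quotient topology of the Zariski topology on $V$. *)

theory Defs
  imports "HOL-Analysis.Analysis" "HOL-Computational_Algebra.Computational_Algebra"
begin

definition irreducible_space :: "'a topology \<Rightarrow> bool" where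
  "irreducible_space X \<longleftrightarrow> topspace X \<noteq> {} \<and>
     (\<forall>C D. closedin X C \<and> closedin X D \<and> topspace X = C \<union> D \<longrightarrow>
        C = topspace X \<or> D = topspace X)"

definition irreducible_in :: "'a topology \<Rightarrow> 'a set \<Rightarrow> bool" where
  "irreducible_in X S \<longleftrightarrow> S \<subseteq> topspace X \<and> irreducible_space (subtopology X S)"

definition quotient_topology :: "'a topology \<Rightarrow> ('a \<Rightarrow> 'b) \<Rightarrow> 'b set \<Rightarrow> 'b topology" where
  "quotient_topology X f B =
     topology (\<lambda>U. U \<subseteq> B \<and> openin X {x \<in> topspace X. f x \<in> U})"

lemma openin_quotient_topology:
  "openin (quotient_topology X f B) U \<longleftrightarrow> U \<subseteq> B \<and> openin X {x \<in> topspace X. f x \<in> U}"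
proof -
  have "istopology (\<lambda>U. U \<subseteq> B \<and> openin X {x \<in> topspace X. f x \<in> U})"
    unfolding istopology_def
  proof (intro conjI allI impI)
    fix S T
    assume S: "S \<subseteq> B \<and> openin X {x \<in> topspace X. f x \<in> S}"
      and T: "T \<subseteq> B \<and> openin X {x \<in> topspace X. f x \<in> T}"
    have "{x \<in> topspace X. f x \<in> S \<inter> T}
        = {x \<in> topspace X. f x \<in> S} \<inter> {x \<in> topspace X. f x \<in> T}"
      by auto
    then show "openin X {x \<in> topspace X. f x \<in> S \<inter> T}"
      using S T by auto
    show "S \<inter> T \<subseteq> B"
      using S by auto
  next
    fix K
    assume K: "\<forall>S\<in>K. S \<subseteq> B \<and> openin X {x \<in> topspace X. f x \<in> S}"
    have "{x \<in> topspace X. f x \<in> \<Union>K} = (\<Union>S\<in>K. {x \<in> topspace X. f x \<in> S})"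
      by auto
    then show "openin X {x \<in> topspace X. f x \<in> \<Union>K}"
      using K by auto
    show "\<Union>K \<subseteq> B"
      using K by auto
  qed
  then show ?thesis
    by (simp only: quotient_topology_def topology_inverse')
qed

text \<open>Points of the affine space with coordinates indexed by a finite set \<open>I\<close> are the
  extensional functions on \<open>I\<close>.\<close>

definition affine_space :: "'i set \<Rightarrow> ('i \<Rightarrow> complex) set" where
  "affine_space I = (\<Pi>\<^sub>E i\<in>I. UNIV)"

inductive polynomial_fun :: "'i set \<Rightarrow> (('i \<Rightarrow> complex) \<Rightarrow> complex) \<Rightarrow> bool"
  for I :: "'i set" where
  const: "polynomial_fun I (\<lambda>x. c)"
| coord: "i \<in> I \<Longrightarrow> polynomial_fun I (\<lambda>x. x i)"
| add: "polynomial_fun I q \<Longrightarrow> polynomial_fun I r \<Longrightarrow> polynomial_fun I (\<lambda>x. q x + r x)"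
| mult: "polynomial_fun I q \<Longrightarrow> polynomial_fun I r \<Longrightarrow> polynomial_fun I (\<lambda>x. q x * r x)"

definition zero_locus ::
    "'i set \<Rightarrow> (('i \<Rightarrow> complex) \<Rightarrow> complex) set \<Rightarrow> ('i \<Rightarrow> complex) set" where
  "zero_locus I Q = {x \<in> affine_space I. \<forall>q\<in>Q. q x = 0}"

definition zariski_topology :: "'i set \<Rightarrow> ('i \<Rightarrow> complex) topology" where
  "zariski_topology I =
     topology (\<lambda>U. \<exists>Q. (\<forall>q\<in>Q. polynomial_fun I q) \<and> U = affine_space I - zero_locus I Q)"

lemma openin_zariski_topology:
  "openin (zariski_topology I) U \<longleftrightarrow>
     (\<exists>Q. (\<forall>q\<in>Q. polynomial_fun I q) \<and> U = affine_space I - zero_locus I Q)"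
proof -
  let ?P = "\<lambda>U Q. (\<forall>q\<in>Q. polynomial_fun I q) \<and> U = affine_space I - zero_locus I Q"
  have "istopology (\<lambda>U. \<exists>Q. ?P U Q)"
    unfolding istopology_def
  proof (intro conjI allI impI)
    fix S T
    assume "\<exists>Q. ?P S Q" "\<exists>Q. ?P T Q"
    then obtain Q R where QR: "?P S Q" "?P T R"
      by blast
    define M where "M = (\<lambda>(q, r) x. q x * r x) ` (Q \<times> R)"
    have "\<forall>q\<in>M. polynomial_fun I q"
      using QR by (auto simp: M_def intro: polynomial_fun.mult)
    moreover have "zero_locus I M = zero_locus I Q \<union> zero_locus I R"
      by (fastforce simp: M_def zero_locus_def)
    then have "S \<inter> T = affine_space I - zero_locus I M"
      using QR by blast
    ultimately show "\<exists>Q. ?P (S \<inter> T) Q"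
      by blast
  next
    fix K
    assume "\<forall>U\<in>K. \<exists>Q. ?P U Q"
    then obtain F where F: "\<forall>U\<in>K. ?P U (F U)"
      using bchoice[of K ?P] by blast
    have "\<Union>K = (\<Union>U\<in>K. U)"
      by simp
    also have "\<dots> = (\<Union>U\<in>K. affine_space I - zero_locus I (F U))"
      using F by (intro SUP_cong) blast+
    also have "\<dots> = affine_space I - zero_locus I (\<Union>U\<in>K. F U)"
      by (auto simp: zero_locus_def)
    finally have "\<Union>K = affine_space I - zero_locus I (\<Union>U\<in>K. F U)" .
    moreover have "\<forall>q\<in>(\<Union>U\<in>K. F U). polynomial_fun I q"
      using F by blast
    ultimately show "\<exists>Q. ?P (\<Union>K) Q"
      by (intro exI conjI)
  qed
  then show ?thesis
    by (simp only: zariski_topology_def topology_inverse')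
qed

definition strictly_preperiodic :: "nat \<Rightarrow> nat \<Rightarrow> complex poly \<Rightarrow> complex \<Rightarrow> bool" where
  "strictly_preperiodic k n g x \<longleftrightarrow>
     (poly g ^^ (k + n)) x = (poly g ^^ k) x \<and>
     (\<forall>l m. l \<le> k \<and> 1 \<le> m \<and> m \<le> n \<and> (l, m) \<noteq> (k, n) \<longrightarrow>
        (poly g ^^ (l + m)) x \<noteq> (poly g ^^ l) x)"

definition marked_polys :: "nat \<Rightarrow> (complex poly \<times> complex) set" where
  "marked_polys d = {(f, \<alpha>). degree f = d \<and> poly (pderiv f) \<alpha> = 0}"

text \<open>With \<open>h z = a * z + b\<close>, the two linear polynomials below are \<open>h\<close> and its inverse.\<close>

definition conj_rel ::
    "nat \<Rightarrow> ((complex poly \<times> complex) \<times> (complex poly \<times> complex)) set" where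
  "conj_rel d = {((f, \<alpha>), (g, \<gamma>)). (f, \<alpha>) \<in> marked_polys d \<and> (g, \<gamma>) \<in> marked_polys d \<and>
     (\<exists>a b. a \<noteq> 0 \<and> g = [:b, a:] \<circ>\<^sub>p f \<circ>\<^sub>p [:- b / a, 1 / a:] \<and> \<gamma> = a * \<alpha> + b)}"

definition moduli_space :: "nat \<Rightarrow> (complex poly \<times> complex) set set" where
  "moduli_space d = marked_polys d // conj_rel d"

text \<open>A point \<open>v\<close> of the parameter space has coordinates \<open>\<alpha>\<^sub>i = v i\<close> for
  \<open>1 \<le> i \<le> d - 1\<close> and \<open>\<beta> = v d\<close>.\<close>

definition param_space :: "nat \<Rightarrow> (nat \<Rightarrow> complex) set" where
  "param_space d = {v \<in> affine_space {1..d}. (\<Sum>i=1..d-1. v i) = 0}"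

definition elem_sym :: "'i set \<Rightarrow> ('i \<Rightarrow> complex) \<Rightarrow> nat \<Rightarrow> complex" where
  "elem_sym I v j = (\<Sum>J | J \<subseteq> I \<and> card J = j. \<Prod>i\<in>J. v i)"

definition param_coeff :: "nat \<Rightarrow> (nat \<Rightarrow> complex) \<Rightarrow> nat \<Rightarrow> complex" where
  "param_coeff d v i = (-1) ^ i * (of_nat d / of_nat (d - i)) * elem_sym {1..d-1} v i"

text \<open>\<open>param_poly d v\<close> is the monic polynomial with derivative
  \<open>d * (\<Prod>i=1..d-1. z - v i)\<close> and value \<open>v d\<close> at \<open>v 1\<close>; its coefficient of \<open>z ^ (d - 1)\<close>
  vanishes because the critical points sum to zero.\<close>

definition param_poly :: "nat \<Rightarrow> (nat \<Rightarrow> complex) \<Rightarrow> complex poly" where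
  "param_poly d v =
     monom 1 d + (\<Sum>i=2..d-1. monom (param_coeff d v i) (d - i))
     + [: - (v 1 ^ d) - (\<Sum>i=2..d-1. param_coeff d v i * v 1 ^ (d - i)) + v d :]"

definition param_class :: "nat \<Rightarrow> (nat \<Rightarrow> complex) \<Rightarrow> (complex poly \<times> complex) set" where
  "param_class d v = conj_rel d `` {(param_poly d v, v 1)}"

text \<open>The fibres of \<open>param_class d\<close> on \<open>param_space d\<close> are the orbits of the finite group by
  which the parameter space is divided, so the topology of the quotient variety, transported to
  the moduli space, is the quotient topology with respect to \<open>param_class d\<close>.\<close>

definition moduli_topology :: "nat \<Rightarrow> (complex poly \<times> complex) set topology" where
  "moduli_topology d =
     quotient_topology (subtopology (zariski_topology {1..d}) (param_space d))
       (param_class d) (moduli_space d)"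

definition preperiodic_locus :: "nat \<Rightarrow> nat \<Rightarrow> nat \<Rightarrow> (complex poly \<times> complex) set set" where
  "preperiodic_locus k n d =
     {conj_rel d `` {(f, \<alpha>)} | f \<alpha>. (f, \<alpha>) \<in> marked_polys d \<and> strictly_preperiodic k n f \<alpha>}"

end

theory Submission
  imports Defs "HOL-Computational_Algebra.Field_as_Ring"
begin

text \<open>
  Since the moduli space carries the quotient topology, irreducibility of the locus says the
  following about the set of all points of the parameter space whose marked critical point is
  strictly preperiodic: if a product \<open>g * h\<close> of polynomial functions vanishes on it, then
  \<open>g u = 0\<close> or \<open>h w = 0\<close> for any two of its points \<open>u\<close> and \<open>w\<close>
  (\<open>param_locus_irreducible\<close>). It is therefore enough to find, through any two points of the
  parameter space, a surface with coordinates \<open>t\<close> and \<open>c\<close> on which the locus is cut out by an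
  irreducible polynomial \<open>F\<close> in two variables and an inequation; by the Nullstellensatz for \<open>F\<close>,
  the prime \<open>F\<close> divides the restriction of \<open>g\<close> or that of \<open>h\<close>.

  Put the marked critical point at \<open>0\<close>, write \<open>f y = c + (\<Sum>j=2..p. e j * y ^ j)\<close> with \<open>e p = 1\<close>,
  and let \<open>X l\<close> be the \<open>l\<close>-th point of the orbit of \<open>0\<close>. The difference \<open>X (l + 2) - X (l + 1)\<close>
  is \<open>X (l + 1) - X l\<close> times a divided difference of \<open>f\<close>, and the latter is divisible by \<open>c\<close>
  because \<open>0\<close> is a critical point. The remaining factor \<open>\<Psi>\<close> (\<open>collision_poly\<close>) is monic in \<open>c\<close>.
  The marked critical point is strictly \<open>(l + 1, 1)\<close>-preperiodic exactly where \<open>\<Psi>\<close> vanishes and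
  \<open>X (l + 1) - X l\<close> does not.

  Irreducibility of \<open>\<Psi>\<close> is where the prime degree enters. Modulo an ideal that contains \<open>p\<close> and
  \<open>e 2, \<dots>, e (p - 1)\<close> the polynomial \<open>f\<close> is \<open>y ^ p + c\<close>, so that the differences
  \<open>X (l + 1) - X l\<close> become \<open>c ^ (p ^ l)\<close> by the Frobenius identity, and \<open>\<Psi>\<close> becomes a power of \<open>c\<close>. Its
  constant term is \<open>e 2\<close> or \<open>2 * e 2\<close>, where \<open>2\<close> is invertible since \<open>p\<close> is odd. This is
  Eisenstein's criterion. As irreducibility is needed over the complex numbers, where \<open>p\<close> has
  roots of all orders, the ideal is generated not just by \<open>p\<close>: choose a valuation ring \<open>R\<close> of the
  complex numbers with maximal ideal containing \<open>p\<close>, and let the coefficients \<open>e j\<close> depend on a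
  parameter \<open>t\<close> in such a way that all of them except \<open>e p\<close> lie in the ideal of \<open>R[t]\<close> generated by the
  maximal ideal and \<open>t\<close>, while \<open>e 2\<close> is a unit times \<open>t\<close> modulo the maximal ideal and \<open>t ^ 2\<close>
  (\<open>eisenstein_two_variables\<close>, \<open>irreducible_collision_poly\<close>). In terms of the critical points this
  is achieved by letting a single one of them be \<open>t / p\<close> and the others \<open>1\<close> up to terms of
  higher order in \<open>t\<close>, and these terms provide enough freedom to pass through two arbitrary points
  (\<open>interpolating_curve\<close>).
\<close>

section \<open>A valuation ring of the complex numbers above a rational prime\<close>

definition subring :: "'a::comm_ring_1 set \<Rightarrow> bool" where
  "subring T \<longleftrightarrow> 1 \<in> T \<and> (\<forall>x\<in>T. \<forall>y\<in>T. x - y \<in> T \<and> x * y \<in> T)"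

lemma subringD:
  assumes "subring T"
  shows "1 \<in> T" "0 \<in> T" "x \<in> T \<Longrightarrow> y \<in> T \<Longrightarrow> x - y \<in> T" "x \<in> T \<Longrightarrow> y \<in> T \<Longrightarrow> x * y \<in> T"
    "x \<in> T \<Longrightarrow> - x \<in> T" "x \<in> T \<Longrightarrow> y \<in> T \<Longrightarrow> x + y \<in> T"
proof -
  show 1: "1 \<in> T" and diff: "\<And>x y. x \<in> T \<Longrightarrow> y \<in> T \<Longrightarrow> x - y \<in> T"
    and "x \<in> T \<Longrightarrow> y \<in> T \<Longrightarrow> x * y \<in> T"
    using assms by (auto simp: subring_def)
  show 0: "0 \<in> T"
    using diff[OF 1 1] by simp
  show minus: "- x \<in> T" if "x \<in> T" for x
    using diff[OF 0 that] by simp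
  show "x \<in> T \<Longrightarrow> y \<in> T \<Longrightarrow> x + y \<in> T"
    using diff[OF _ minus, of x y] by simp
qed

lemma subring_sum: "subring T \<Longrightarrow> (\<And>i. i \<in> A \<Longrightarrow> f i \<in> T) \<Longrightarrow> sum f A \<in> T"
  by (induction A rule: infinite_finite_induct) (auto intro: subringD)

lemma subring_prod: "subring T \<Longrightarrow> (\<And>i. i \<in> A \<Longrightarrow> f i \<in> T) \<Longrightarrow> prod f A \<in> T"
  by (induction A rule: infinite_finite_induct) (auto intro: subringD)

lemma subring_power: "subring T \<Longrightarrow> x \<in> T \<Longrightarrow> x ^ n \<in> T"
  by (induction n) (auto intro: subringD)

lemma subring_of_nat: "subring T \<Longrightarrow> of_nat n \<in> T"
  by (induction n) (auto intro: subringD)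

lemma subring_Ints: "subring (\<int> :: complex set)"
  by (auto simp: subring_def)

text \<open>Polynomials with all coefficients in a given subset of the coefficient ring.\<close>

definition coeffs_in :: "'a::zero set \<Rightarrow> 'a poly set" where
  "coeffs_in T = {q. \<forall>i. coeff q i \<in> T}"

lemma subring_coeffs_in:
  assumes "subring T"
  shows "subring (coeffs_in T)"
  unfolding subring_def coeffs_in_def
  by (auto simp: coeff_mult coeff_1 intro!: subring_sum subringD assms)

lemma subring_adjoin:
  assumes "subring T"
  shows "subring ((\<lambda>q. poly q x) ` coeffs_in T)"
proof -
  note S = subring_coeffs_in[OF assms]
  show ?thesis
    unfolding subring_def
  proof (intro conjI ballI; (elim imageE)?)
    show "1 \<in> (\<lambda>q. poly q x) ` coeffs_in T"
      by (rule image_eqI[where x = 1]) (auto intro: subringD[OF S])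
  next
    fix y z q r
    assume *: "y = poly q x" "z = poly r x" "q \<in> coeffs_in T" "r \<in> coeffs_in T"
    show "y - z \<in> (\<lambda>q. poly q x) ` coeffs_in T"
      by (rule image_eqI[where x = "q - r"]) (auto intro: subringD[OF S] simp: *)
    show "y * z \<in> (\<lambda>q. poly q x) ` coeffs_in T"
      by (rule image_eqI[where x = "q * r"]) (auto intro: subringD[OF S] simp: *)
  qed
qed

lemma pCons_in_coeffs_in: "pCons a q \<in> coeffs_in T \<longleftrightarrow> a \<in> T \<and> q \<in> coeffs_in T"
  by (auto simp: coeffs_in_def coeff_pCons split: nat.splits)

lemma const_in_coeffs_in: "0 \<in> T \<Longrightarrow> [:a:] \<in> coeffs_in T \<longleftrightarrow> a \<in> T"
  by (simp add: pCons_in_coeffs_in) (simp add: coeffs_in_def)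

lemma poly_eq_sum_le:
  fixes x :: "'a::comm_ring_1"
  shows "degree q \<le> n \<Longrightarrow> poly q x = (\<Sum>i\<le>n. coeff q i * x ^ i)"
  by (subst poly_altdef, rule sum.mono_neutral_left) (auto simp: coeff_eq_0)

text \<open>The degree of the relation \<open>poly q x = 1\<close> can be lowered with the help of a relation of
  no larger degree for \<open>inverse x\<close>: with \<open>c\<close> the constant coefficient of the
  second relation, \<open>1 - c\<close> times the leading term of the first can be rewritten in lower
  powers of \<open>x\<close>.\<close>

lemma lower_relation:
  fixes x :: "'a::field"
  assumes T: "subring T" and J: "J \<subseteq> T" "0 \<in> J" "\<And>a b. a \<in> J \<Longrightarrow> b \<in> J \<Longrightarrow> a + b \<in> J"
    "\<And>a b. a \<in> T \<Longrightarrow> b \<in> J \<Longrightarrow> a * b \<in> J"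
    and x: "x \<noteq> 0"
    and q: "q \<in> coeffs_in J" "poly q x = 1" "degree q \<le> n"
    and r: "r \<in> coeffs_in J" "poly r (inverse x) = 1" "degree r \<le> m"
    and mn: "m \<le> n" "0 < n"
  shows "\<exists>s \<in> coeffs_in J. poly s x = 1 \<and> degree s < n"
proof -
  define a c where "a = coeff q" and "c = coeff r"
  have aJ: "a i \<in> J" and cJ: "c i \<in> J" for i
    using q r by (auto simp: coeffs_in_def a_def c_def)
  have eq1: "(\<Sum>i\<le>n. a i * x ^ i) = 1"
    using q poly_eq_sum_le[of q n x] by (simp add: a_def)
  have eq2: "(\<Sum>i\<le>m. c i * inverse x ^ i) = 1"
    using r poly_eq_sum_le[of r m "inverse x"] by (simp add: c_def)
  define s where "s = [:c 0:] + (\<Sum>i<n. monom ((1 - c 0) * a i) i)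
                   + (\<Sum>j=1..m. monom (a n * c j) (n - j))"
  have "1 - c 0 = (\<Sum>j=1..m. c j * inverse x ^ j)"
    using eq2 by (simp add: atMost_atLeast0 sum.atLeast_Suc_atMost algebra_simps)
  moreover have "c j * inverse x ^ j * x ^ n = c j * x ^ (n - j)" if "j \<in> {1..m}" for j
  proof -
    have "x ^ n = x ^ j * x ^ (n - j)"
      using that mn by (simp flip: power_add)
    moreover have "inverse x ^ j * x ^ j = 1"
      using x by (simp flip: power_mult_distrib)
    ultimately show ?thesis
      by (simp add: mult.assoc)
  qed
  ultimately have "(1 - c 0) * x ^ n = (\<Sum>j=1..m. c j * x ^ (n - j))"
    by (simp only: sum_distrib_right cong: sum.cong)
  then have eq3: "(1 - c 0) * (a n * x ^ n) = (\<Sum>j=1..m. a n * c j * x ^ (n - j))"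
    by (simp add: sum_distrib_left mult.assoc mult.left_commute)
  have "1 = c 0 + (1 - c 0) * (\<Sum>i\<le>n. a i * x ^ i)"
    using eq1 by simp
  also have "(\<Sum>i\<le>n. a i * x ^ i) = (\<Sum>i<n. a i * x ^ i) + a n * x ^ n"
    by (simp flip: lessThan_Suc_atMost)
  also have "c 0 + (1 - c 0) * ((\<Sum>i<n. a i * x ^ i) + a n * x ^ n) = poly s x"
    by (simp add: s_def poly_sum poly_monom distrib_left eq3 sum_distrib_left mult.assoc)
  finally have "poly s x = 1"
    by simp
  moreover have "degree s < n"
  proof -
    have "degree (\<Sum>i<n. monom ((1 - c 0) * a i) i) < n" 
      by (rule degree_sum_less) (use mn in \<open>auto intro: le_less_trans[OF degree_monom_le]\<close>)
    moreover have "degree (\<Sum>j=1..m. monom (a n * c j) (n - j)) < n"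
      by (rule degree_sum_less) (use mn in \<open>auto intro: le_less_trans[OF degree_monom_le]\<close>)
    ultimately show ?thesis
      using mn unfolding s_def by (intro degree_add_less) auto
  qed
  moreover have "s \<in> coeffs_in J"
  proof -
    have add: "f + g \<in> coeffs_in J" if "f \<in> coeffs_in J" "g \<in> coeffs_in J" for f g
      using that J by (auto simp: coeffs_in_def)
    have sum: "sum f A \<in> coeffs_in J" if "\<And>i. i \<in> A \<Longrightarrow> f i \<in> coeffs_in J" for f and A :: "nat set"
      using that J by (induction A rule: infinite_finite_induct)
        (auto intro!: add simp: coeffs_in_def)
    have mon: "monom b i \<in> coeffs_in J" if "b \<in> J" for b i
      using that J by (auto simp: coeffs_in_def)
    have "a i \<in> T" "1 - c 0 \<in> T" for i
      using aJ[of i] cJ[of 0] J(1) by (auto intro: subringD(1,3)[OF T])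
    then show ?thesis
      unfolding s_def
      by (intro add sum mon J(4) aJ cJ) (auto simp: const_in_coeffs_in J(2) cJ)
  qed
  ultimately show ?thesis
    by blast
qed

definition valuation_ring :: "'a::field set \<Rightarrow> bool" where
  "valuation_ring R \<longleftrightarrow> subring R \<and> (\<forall>x. x \<in> R \<or> inverse x \<in> R)"

text \<open>A subring that is maximal among those in which a given element is not invertible is a
  valuation ring: if it contained neither \<open>x\<close> nor \<open>inverse x\<close>, then adjoining either of them
  would make the element invertible, and relations of minimal degree witnessing this could be
  played off against each other.\<close>

lemma exists_valuation_ring:
  fixes a :: "'a::field"
  assumes T: "subring T" "a \<in> T" "inverse a \<notin> T"
  shows "\<exists>R. valuation_ring R \<and> T \<subseteq> R \<and> inverse a \<notin> R"
proof -
  define F where "F = {R. subring R \<and> T \<subseteq> R \<and> inverse a \<notin> R}"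
  have "\<exists>M\<in>F. \<forall>X\<in>F. M \<subseteq> X \<longrightarrow> X = M"
  proof (rule subset_Zorn_nonempty)
    show "F \<noteq> {}"
      using T by (auto simp: F_def)
  next
    fix C assume C: "C \<noteq> {}" "subset.chain F C"
    then have sub: "C \<subseteq> F" and ch: "\<And>X Y. X \<in> C \<Longrightarrow> Y \<in> C \<Longrightarrow> X \<subseteq> Y \<or> Y \<subseteq> X"
      by (auto simp: subset.chain_def)
    have "subring (\<Union>C)"
      unfolding subring_def
    proof (intro conjI ballI)
      show "1 \<in> \<Union>C"
        using C sub by (auto simp: F_def subring_def)
    next
      fix x y assume "x \<in> \<Union>C" "y \<in> \<Union>C"
      then obtain X where "X \<in> C" "x \<in> X" "y \<in> X"
        using ch by blast
      then have "x - y \<in> X" "x * y \<in> X"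
        using sub by (auto simp: F_def subring_def)
      then show "x - y \<in> \<Union>C" "x * y \<in> \<Union>C"
        using \<open>X \<in> C\<close> by auto
    qed
    then show "\<Union>C \<in> F"
      using C sub by (auto simp: F_def)
  qed
  then obtain R where RF: "R \<in> F" and max: "\<And>X. X \<in> F \<Longrightarrow> R \<subseteq> X \<Longrightarrow> X = R"
    by blast
  then have R: "subring R" "T \<subseteq> R" "inverse a \<notin> R"
    by (auto simp: F_def)
  have aR: "a \<in> R"
    using R T by auto
  have a0: "a \<noteq> 0"
    using R subringD(2)[of R] by auto
  define J where "J = (\<lambda>b. a * b) ` R"
  have J: "J \<subseteq> R" "0 \<in> J" "\<And>b c. b \<in> J \<Longrightarrow> c \<in> J \<Longrightarrow> b + c \<in> J"
    "\<And>b c. b \<in> R \<Longrightarrow> c \<in> J \<Longrightarrow> b * c \<in> J"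
  proof -
    show "J \<subseteq> R" 
      using aR by (auto simp: J_def intro: subringD[OF R(1)])
    show "0 \<in> J"
      by (auto simp: J_def intro!: image_eqI[where x = 0] subringD[OF R(1)])
    show "b + c \<in> J" if "b \<in> J" "c \<in> J" for b c
      using that by (auto simp: J_def distrib_left[symmetric] intro!: subringD[OF R(1)])
    show "b * c \<in> J" if "b \<in> R" "c \<in> J" for b c
      using that by (auto simp: J_def mult.left_commute[of b] intro!: subringD[OF R(1)])
  qed
  have one_J: "1 \<notin> J"
  proof
    assume "1 \<in> J"
    then obtain b where b: "b \<in> R" "a * b = 1"
      by (auto simp: J_def)
    then have "b = inverse a"
      using a0 by (simp add: field_simps)
    with b R show False
      by simp
  qed
  have rel: "\<exists>q \<in> coeffs_in J. poly q x = 1" if "x \<notin> R" for x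
  proof -
    let ?X = "(\<lambda>q. poly q x) ` coeffs_in R"
    have "R \<subseteq> ?X"
    proof
      fix y assume "y \<in> R"
      then show "y \<in> ?X"
        by (intro image_eqI[where x = "[:y:]"]) (simp_all add: const_in_coeffs_in subringD(2)[OF R(1)])
    qed
    moreover have "x \<in> ?X"
      by (rule image_eqI[where x = "[:0, 1:]"])
        (simp_all add: pCons_in_coeffs_in[of 0] const_in_coeffs_in subringD(1,2)[OF R(1)])
    ultimately have "?X \<notin> F"
      using max that by blast
    then have "inverse a \<in> ?X"
      using subring_adjoin[OF R(1)] \<open>R \<subseteq> ?X\<close> R by (auto simp: F_def)
    then obtain q where q: "q \<in> coeffs_in R" "poly q x = inverse a"
      by auto
    have "smult a q \<in> coeffs_in J" "poly (smult a q) x = 1"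
      using q a0 by (auto simp: coeffs_in_def J_def)
    then show ?thesis by blast
  qed
  have "x \<in> R \<or> inverse x \<in> R" for x
  proof (rule ccontr)
    assume "\<not> ?thesis"
    then have x: "x \<notin> R" "inverse x \<notin> R" by auto
    have x0: "x \<noteq> 0" using x subringD(2)[OF R(1)] by auto
    define P where "P = (\<lambda>y n. \<exists>q \<in> coeffs_in J. poly q y = 1 \<and> degree q = n)"
    define n where "n = (LEAST n. P x n)"
    define m where "m = (LEAST n. P (inverse x) n)"
    have ex: "\<exists>n. P y n" if "y \<notin> R" for y
      using rel[OF that] unfolding P_def by blast
    have Pn: "P x n" and Pm: "P (inverse x) m"
      unfolding n_def m_def by (rule LeastI_ex[OF ex[OF x(1)]], rule LeastI_ex[OF ex[OF x(2)]])
    have pos: "k > 0" if Pk: "P y k" for y k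
    proof (rule ccontr)
      assume "\<not> k > 0"
      then obtain q where q: "q \<in> coeffs_in J" "poly q y = 1" "degree q = 0"
        using Pk by (auto simp: P_def)
      then obtain b where "q = [:b:]" by (auto elim: degree_eq_zeroE)
      with q one_J show False
        by (auto simp: pCons_in_coeffs_in)
    qed
    from Pn obtain q where q: "q \<in> coeffs_in J" "poly q x = 1" "degree q = n"
      by (auto simp: P_def)
    from Pm obtain r where r: "r \<in> coeffs_in J" "poly r (inverse x) = 1" "degree r = m"
      by (auto simp: P_def)
    show False
    proof (cases "m \<le> n")
      case True
      have "\<exists>s \<in> coeffs_in J. poly s x = 1 \<and> degree s < n"
        by (rule lower_relation[OF R(1) J x0 q(1,2) _ r(1,2)]) (use q r True pos[OF Pn] in auto)
      then show False
        using not_less_Least[of _ "P x"] unfolding P_def n_def by blast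
    next
      case False
      have "\<exists>s \<in> coeffs_in J. poly s (inverse x) = 1 \<and> degree s < m"
        by (rule lower_relation[OF R(1) J _ r(1,2) _ q(1)[]])
          (use q r x0 False pos[OF Pm] in auto)
      then show False
        using not_less_Least[of _ "P (inverse x)"] unfolding P_def m_def by blast
    qed
  qed
  then have "valuation_ring R"
    using R by (auto simp: valuation_ring_def)
  then show ?thesis
    using R by blast
qed

section \<open>Gauss's lemma and Eisenstein's criterion over a valuation ring\<close>

definition prime_ideal_of :: "'a::comm_ring_1 set \<Rightarrow> 'a set \<Rightarrow> bool" where
  "prime_ideal_of T J \<longleftrightarrow> subring T \<and> J \<subseteq> T \<and> 0 \<in> J \<and> 1 \<notin> J \<and>
     (\<forall>x\<in>J. \<forall>y\<in>J. x + y \<in> J) \<and> (\<forall>x\<in>T. \<forall>y\<in>J. x * y \<in> J) \<and>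
     (\<forall>x\<in>T. \<forall>y\<in>T. x * y \<in> J \<longrightarrow> x \<in> J \<or> y \<in> J)"

lemma prime_ideal_ofD:
  assumes "prime_ideal_of T J"
  shows "subring T" "J \<subseteq> T" "x \<in> J \<Longrightarrow> x \<in> T" "0 \<in> J" "1 \<notin> J"
    "x \<in> J \<Longrightarrow> y \<in> J \<Longrightarrow> x + y \<in> J"
    "x \<in> T \<Longrightarrow> y \<in> J \<Longrightarrow> x * y \<in> J" "x \<in> J \<Longrightarrow> y \<in> T \<Longrightarrow> x * y \<in> J"
    "x \<in> T \<Longrightarrow> y \<in> T \<Longrightarrow> x * y \<in> J \<Longrightarrow> x \<in> J \<or> y \<in> J"
    "x \<in> J \<Longrightarrow> - x \<in> J" "x \<in> J \<Longrightarrow> y \<in> J \<Longrightarrow> x - y \<in> J"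
proof -
  show T: "subring T" "J \<subseteq> T" "x \<in> J \<Longrightarrow> x \<in> T" "0 \<in> J" "1 \<notin> J"
    and add: "\<And>x y. x \<in> J \<Longrightarrow> y \<in> J \<Longrightarrow> x + y \<in> J"
    and left: "\<And>x y. x \<in> T \<Longrightarrow> y \<in> J \<Longrightarrow> x * y \<in> J"
    and "x \<in> T \<Longrightarrow> y \<in> T \<Longrightarrow> x * y \<in> J \<Longrightarrow> x \<in> J \<or> y \<in> J"
    using assms unfolding prime_ideal_of_def by blast+
  show "x \<in> J \<Longrightarrow> y \<in> T \<Longrightarrow> x * y \<in> J"
    using left[of y x] by (simp add: mult.commute)
  have "- 1 \<in> T"
    using T by (auto intro: subringD)
  from left[OF this] show minus: "- x \<in> J" if "x \<in> J" for x
    using that by (metis mult_minus1)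
  show "x \<in> J \<Longrightarrow> y \<in> J \<Longrightarrow> x - y \<in> J"
    using add[OF _ minus, of x y] by simp
qed

lemma prime_ideal_sum:
  "prime_ideal_of T J \<Longrightarrow> (\<And>i. i \<in> A \<Longrightarrow> f i \<in> J) \<Longrightarrow> sum f A \<in> J"
  by (induction A rule: infinite_finite_induct) (auto intro: prime_ideal_ofD(4,6))

lemma prime_ideal_power:
  assumes "prime_ideal_of T J" "x \<in> J" "0 < n"
  shows "x ^ n \<in> J"
proof -
  have "x * x ^ (n - 1) \<in> J"
    using assms(1,2) by (intro prime_ideal_ofD(8)[OF assms(1)] subring_power) (auto dest: prime_ideal_ofD(1,3))
  then show ?thesis
    using assms(3) by (simp add: power_eq_if)
qed

text \<open>Modulo the prime ideal \<open>J\<close>, the product of two polynomials begins with the product of the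
  first nonvanishing terms.\<close>

lemma first_coeff_mult:
  assumes J: "prime_ideal_of T J" and f: "f \<in> coeffs_in T" and g: "g \<in> coeffs_in T"
    and i: "coeff f i \<notin> J" "\<And>k. k < i \<Longrightarrow> coeff f k \<in> J"
    and j: "coeff g j \<notin> J" "\<And>k. k < j \<Longrightarrow> coeff g k \<in> J"
  shows "coeff (f * g) (i + j) \<notin> J"
proof
  assume *: "coeff (f * g) (i + j) \<in> J"
  note D = prime_ideal_ofD[OF J]
  have fT: "coeff f k \<in> T" and gT: "coeff g k \<in> T" for k
    using f g by (auto simp: coeffs_in_def)
  have "coeff (f * g) (i + j) = (\<Sum>k\<le>i+j. coeff f k * coeff g (i + j - k))"
    by (rule coeff_mult)
  also have "\<dots> = coeff f i * coeff g j + (\<Sum>k\<in>{..i+j}-{i}. coeff f k * coeff g (i + j - k))"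
    by (subst sum.remove[of _ i]) auto
  finally have eq: "coeff f i * coeff g j =
      coeff (f * g) (i + j) - (\<Sum>k\<in>{..i+j}-{i}. coeff f k * coeff g (i + j - k))"
    by simp
  have "coeff f k * coeff g (i + j - k) \<in> J" if "k \<in> {..i+j}-{i}" for k
  proof (cases "k < i")
    case True
    then show ?thesis using i fT gT by (intro D(8)) auto
  next
    case False
    then have "i + j - k < j" using that by auto
    then show ?thesis using j fT gT by (intro D(7)) auto
  qed
  then have "coeff f i * coeff g j \<in> J"
    unfolding eq using * by (intro D(11) prime_ideal_sum[OF J])
  then show False
    using D(9) fT gT i j by blast
qed

lemma first_coeff_exists:
  assumes "f \<in> coeffs_in T" "f \<notin> coeffs_in J"
  obtains i where "coeff f i \<notin> J" "\<And>k. k < i \<Longrightarrow> coeff f k \<in> J"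
proof -
  have "\<exists>i. coeff f i \<notin> J"
    using assms by (auto simp: coeffs_in_def)
  then show ?thesis
    using that[of "LEAST i. coeff f i \<notin> J"] LeastI_ex[of "\<lambda>i. coeff f i \<notin> J"]
      not_less_Least[of _ "\<lambda>i. coeff f i \<notin> J"] by blast
qed

lemma prime_ideal_coeffs_in:
  assumes J: "prime_ideal_of T J"
  shows "prime_ideal_of (coeffs_in T) (coeffs_in J)"
proof -
  note D = prime_ideal_ofD[OF J]
  have "f \<in> coeffs_in J \<or> g \<in> coeffs_in J"
    if fg: "f \<in> coeffs_in T" "g \<in> coeffs_in T" "f * g \<in> coeffs_in J" for f g
  proof (rule ccontr)
    assume "\<not> ?thesis"
    then obtain i j where "coeff f i \<notin> J" "\<And>k. k < i \<Longrightarrow> coeff f k \<in> J"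
      "coeff g j \<notin> J" "\<And>k. k < j \<Longrightarrow> coeff g k \<in> J"
      using fg by (metis first_coeff_exists)
    then have "coeff (f * g) (i + j) \<notin> J"
      by (intro first_coeff_mult[OF J fg(1,2)])
    with fg show False by (auto simp: coeffs_in_def)
  qed
  moreover have "f * g \<in> coeffs_in J" if "f \<in> coeffs_in T" "g \<in> coeffs_in J" for f g
    using that by (auto simp: coeffs_in_def coeff_mult intro!: prime_ideal_sum[OF J] D(7))
  moreover have "(1::'a poly) \<notin> coeffs_in J"
    using D(5) by (auto simp: coeffs_in_def intro!: exI[of _ 0])
  ultimately show ?thesis
    unfolding prime_ideal_of_def
    using subring_coeffs_in[OF D(1)] D(2,4)
    by (intro conjI ballI) (auto simp: coeffs_in_def intro: D(6))
qed

text \<open>The ideal generated by \<open>J\<close> and the indeterminate.\<close>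

definition extend_by_var :: "'a::comm_ring_1 set \<Rightarrow> 'a set \<Rightarrow> 'a poly set" where
  "extend_by_var T J = {q \<in> coeffs_in T. coeff q 0 \<in> J}"

lemma prime_ideal_extend_by_var:
  assumes J: "prime_ideal_of T J"
  shows "prime_ideal_of (coeffs_in T) (extend_by_var T J)"
proof -
  note D = prime_ideal_ofD[OF J]
  have T: "coeff q i \<in> T" if "q \<in> coeffs_in T" for q i
    using that by (auto simp: coeffs_in_def)
  show ?thesis
    unfolding prime_ideal_of_def extend_by_var_def
    using subring_coeffs_in[OF D(1)] D(4,5)
    by (intro conjI ballI) (auto simp: coeff_mult T D(6,7) dest: D(9)[rotated 2]
      intro: subringD[OF subring_coeffs_in[OF D(1)]])
qed

definition nonunits :: "'a::comm_ring_1 set \<Rightarrow> 'a set" where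
  "nonunits R = {x \<in> R. \<forall>y\<in>R. x * y \<noteq> 1}"

lemma inverse_in_valuation_ring:
  fixes x :: "'a::field"
  assumes "x \<in> R - nonunits R"
  shows "inverse x \<in> R"
proof -
  obtain y where y: "y \<in> R" "x * y = 1"
    using assms by (auto simp: nonunits_def)
  then have "inverse x = y"
    by (rule_tac inverse_unique)
  with y show ?thesis by simp
qed

lemma prime_ideal_nonunits:
  assumes R: "valuation_ring R"
  shows "prime_ideal_of R (nonunits R)"
proof -
  have S: "subring R" and V: "\<And>x. x \<in> R \<or> inverse x \<in> R"
    using R by (auto simp: valuation_ring_def)
  note D = subringD[OF S]
  have mult: "x * y \<in> nonunits R" if "x \<in> R" "y \<in> nonunits R" for x y
  proof -
    have "x * y * z \<noteq> 1" if z: "z \<in> R" for z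
    proof
      assume "x * y * z = 1"
      then have "y * (x * z) = 1" by (simp add: algebra_simps)
      moreover have "x * z \<in> R" using \<open>x \<in> R\<close> z by (rule D(4))
      ultimately show False using \<open>y \<in> nonunits R\<close> by (auto simp: nonunits_def)
    qed
    then show ?thesis using that D(4) by (auto simp: nonunits_def)
  qed
  \<comment> \<open>Of two nonzero elements one divides the other in \<open>R\<close>, so their sum is a multiple of one
     of them.\<close>
  have add1: "x + y \<in> nonunits R"
    if "x \<in> nonunits R" "y \<in> nonunits R" "x * inverse y \<in> R" "y \<noteq> 0" for x y
  proof -
    have "x + y = (1 + x * inverse y) * y"
      using that by (simp add: field_simps)
    moreover have "1 + x * inverse y \<in> R"
      using that by (intro D(1,6))
    ultimately show ?thesis
      using mult that by metis
  qed
  have add: "x + y \<in> nonunits R" if xy: "x \<in> nonunits R" "y \<in> nonunits R" for x y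
  proof (cases "x = 0 \<or> y = 0")
    case False
    have "x * inverse y \<in> R \<or> y * inverse x \<in> R"
      using V[of "x * inverse y"] by (simp add: mult.commute)
    then show ?thesis
      using add1[of x y] add1[of y x] xy False by (auto simp: add.commute)
  qed (use xy in auto)
  have prime: "x \<in> nonunits R \<or> y \<in> nonunits R"
    if "x \<in> R" "y \<in> R" "x * y \<in> nonunits R" for x y
  proof (rule ccontr)
    assume "\<not> ?thesis"
    then have "inverse x \<in> R" "inverse y \<in> R" "x \<noteq> 0" "y \<noteq> 0"
      using that by (auto intro!: inverse_in_valuation_ring simp: nonunits_def)
    then have "inverse x * inverse y \<in> R" "(x * y) * (inverse x * inverse y) = 1"
      using D(4) by (blast, simp add: field_simps)
    then show False using that by (auto simp: nonunits_def)
  qed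
  show ?thesis
    unfolding prime_ideal_of_def
    using S D(1,2) add mult prime
    by (intro conjI) (simp_all, auto simp: nonunits_def)
qed

text \<open>A finite set of field elements has an element that divides all the others in \<open>R\<close>.\<close>

lemma valuation_ring_normalize_finite:
  fixes A :: "'a::field set"
  assumes R: "valuation_ring R" and A: "finite A" "A - {0} \<noteq> {}"
  shows "\<exists>s. s \<noteq> 0 \<and> (\<lambda>a. s * a) ` A \<subseteq> R \<and> 1 \<in> (\<lambda>a. s * a) ` A"
  using A
proof (induction A rule: finite_induct)
  case (insert x A)
  have S: "subring R" and V: "\<And>x. x \<in> R \<or> inverse x \<in> R"
    using R by (auto simp: valuation_ring_def)
  note D = subringD[OF S]
  show ?case
  proof (cases "A - {0} = {}")
    case True
    then have "x \<noteq> 0" using insert.prems by auto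
    then show ?thesis
      using True D(1,2) by (intro exI[of _ "inverse x"]) auto
  next
    case False
    then obtain s where s: "s \<noteq> 0" "(\<lambda>a. s * a) ` A \<subseteq> R" "1 \<in> (\<lambda>a. s * a) ` A"
      using insert by auto
    show ?thesis
    proof (cases "s * x \<in> R")
      case True
      with s show ?thesis by auto
    next
      case no: False
      then have x: "x \<noteq> 0" "inverse (s * x) \<in> R"
        using V[of "s * x"] D(2) by auto
      have "inverse x * a \<in> R" if "a \<in> A" for a
      proof -
        have "inverse x * a = inverse (s * x) * (s * a)"
          using s by simp
        then show ?thesis using that s(2) x(2) D(4) by (metis image_subset_iff)
      qed
      then show ?thesis
        using x D(1) by (intro exI[of _ "inverse x"]) auto
    qed
  qed
qed auto

text \<open>A polynomial in two variables divided by a coefficient of smallest valuation is primitive.\<close>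

lemma primitive_multiple:
  fixes A :: "'a::field poly poly"
  assumes R: "valuation_ring R" and A: "A \<noteq> 0"
  obtains s where "s \<noteq> 0" "smult [:s:] A \<in> coeffs_in (coeffs_in R)"
    "smult [:s:] A \<notin> coeffs_in (coeffs_in (nonunits R))"
proof -
  define C where "C = (\<Union>q\<in>set (coeffs A). set (coeffs q))"
  have S: "subring R"
    using R by (auto simp: valuation_ring_def)
  have fin: "finite C"
    by (auto simp: C_def)
  have "lead_coeff (lead_coeff A) \<in> C - {0}"
    unfolding C_def using A by (auto simp: coeffs_eq_Nil intro!: bexI[of _ "lead_coeff A"] coeff_in_coeffs)
  then obtain s where s: "s \<noteq> 0" "(\<lambda>a. s * a) ` C \<subseteq> R" "1 \<in> (\<lambda>a. s * a) ` C"
    using valuation_ring_normalize_finite[OF R fin] by blast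
  have mem: "coeff (coeff A i) j \<in> C \<or> coeff (coeff A i) j = 0" for i j
  proof (cases "coeff (coeff A i) j = 0")
    case False
    then have "j \<le> degree (coeff A i)" "coeff A i \<noteq> 0" "A \<noteq> 0"
      by (auto simp: le_degree)
    then have "coeff A i \<in> set (coeffs A)" "coeff (coeff A i) j \<in> set (coeffs (coeff A i))"
      by (auto intro!: coeff_in_coeffs le_degree)
    then show ?thesis by (auto simp: C_def)
  qed auto
  have "s * coeff (coeff A i) j \<in> R" for i j
    using mem[of i j] s subringD(2)[OF S] by auto
  then have "smult [:s:] A \<in> coeffs_in (coeffs_in R)"
    by (auto simp: coeffs_in_def)
  moreover
  obtain q a where q: "q \<in> set (coeffs A)" "a \<in> set (coeffs q)" "s * a = 1"
    using s by (auto simp: C_def)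
  then obtain i j where "q = coeff A i" "a = coeff q j"
    by (auto simp: coeffs_def split: if_splits)
  then have "coeff (coeff (smult [:s:] A) i) j = 1"
    using q by simp
  moreover have "1 \<notin> nonunits R"
    using subringD(1)[OF S] by (auto simp: nonunits_def)
  ultimately show ?thesis
    using that[of s] s by (metis (mono_tags, lifting) coeffs_in_def mem_Collect_eq)
qed

text \<open>Gauss's lemma: the primitive multiples of the two factors have a primitive product, which
  forces the scaling factors to be units.\<close>

lemma gauss_lemma_monic:
  fixes A B :: "'a::field poly poly"
  assumes R: "valuation_ring R" and AB: "A * B \<in> coeffs_in (coeffs_in R)"
    and A: "lead_coeff A = 1" and B: "lead_coeff B = 1"
  shows "A \<in> coeffs_in (coeffs_in R)"
proof -
  have nz: "A \<noteq> 0" "B \<noteq> 0" using A B by auto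
  note JR = prime_ideal_nonunits[OF R]
  note JJ = prime_ideal_coeffs_in[OF prime_ideal_coeffs_in[OF JR]]
  note D = prime_ideal_ofD[OF JR]
  obtain s where s: "s \<noteq> 0" "smult [:s:] A \<in> coeffs_in (coeffs_in R)"
    "smult [:s:] A \<notin> coeffs_in (coeffs_in (nonunits R))"
    using primitive_multiple[OF R nz(1)] by blast
  obtain r where r: "r \<noteq> 0" "smult [:r:] B \<in> coeffs_in (coeffs_in R)"
    "smult [:r:] B \<notin> coeffs_in (coeffs_in (nonunits R))"
    using primitive_multiple[OF R nz(2)] by blast
  have "coeff (coeff (smult [:s:] A) (degree A)) 0 \<in> R"
    using s by (auto simp: coeffs_in_def)
  then have sR: "s \<in> R" using A by simp
  have "coeff (coeff (smult [:r:] B) (degree B)) 0 \<in> R"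
    using r by (auto simp: coeffs_in_def)
  then have rR: "r \<in> R" using B by simp
  have "smult [:s:] A * smult [:r:] B \<notin> coeffs_in (coeffs_in (nonunits R))"
    using prime_ideal_ofD(9)[OF JJ] s r by blast
  moreover have "smult [:s:] A * smult [:r:] B = smult [:s * r:] (A * B)"
    by (simp add: mult.commute)
  ultimately have "\<not> (\<forall>i j. s * r * coeff (coeff (A * B) i) j \<in> nonunits R)"
    by (auto simp: coeffs_in_def)
  then have "s * r \<notin> nonunits R"
    using AB D(8) by (auto simp: coeffs_in_def)
  then have "s \<notin> nonunits R"
    using D(8)[OF _ rR] by blast
  then have inv: "inverse s \<in> R"
    using sR inverse_in_valuation_ring by blast
  have "coeff (coeff A i) j = inverse s * coeff (coeff (smult [:s:] A) i) j" for i j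
    using s by simp
  then show ?thesis
    using inv s subringD(4)[OF D(1)] unfolding coeffs_in_def mem_Collect_eq by metis
qed

text \<open>If a polynomial reduces modulo a prime ideal to its leading term, then in a factorization
  a factor with constant term outside the ideal must be constant: the first nonvanishing
  coefficient of the other factor is visible in the product.\<close>

lemma degree_cofactor:
  fixes A B :: "'a::idom poly"
  assumes J: "prime_ideal_of T J" and A: "A \<in> coeffs_in T" and B: "B \<in> coeffs_in T"
    and low: "\<And>i. i < degree (A * B) \<Longrightarrow> coeff (A * B) i \<in> J"
    and lead: "lead_coeff (A * B) \<notin> J" and B0: "coeff B 0 \<notin> J"
  shows "degree B = 0"
proof -
  note D = prime_ideal_ofD[OF J]
  have "A \<notin> coeffs_in J"
  proof
    assume "A \<in> coeffs_in J"
    then have "A * B \<in> coeffs_in J"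
      using prime_ideal_ofD(8)[OF prime_ideal_coeffs_in[OF J]] B by blast
    with lead show False by (auto simp: coeffs_in_def)
  qed
  then obtain i where i: "coeff A i \<notin> J" "\<And>k. k < i \<Longrightarrow> coeff A k \<in> J"
    using first_coeff_exists[OF A] by blast
  have "coeff (A * B) (i + 0) \<notin> J"
    by (rule first_coeff_mult[OF J A B i B0]) auto
  then have "degree (A * B) \<le> i"
    using low by (metis add_0_right not_le)
  moreover have "i \<le> degree A"
    using i(1) D(4) by (metis le_degree)
  moreover have "A * B \<noteq> 0"
    using lead D(4) by auto
  ultimately show ?thesis
    by (auto simp: degree_mult_eq)
qed

text \<open>Eisenstein's criterion for the prime ideal generated by the maximal ideal of the valuation
  ring and the inner variable: since the coefficient of this variable in the constant term is a
  unit, the constant term is not in the square of the ideal.\<close>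

lemma eisenstein_two_variables:
  fixes F :: "'a::field poly poly"
  assumes R: "valuation_ring R" and F: "F \<in> coeffs_in (coeffs_in R)"
    and monic: "lead_coeff F = 1" and deg: "0 < degree F"
    and low: "\<And>i. i < degree F \<Longrightarrow> coeff (coeff F i) 0 \<in> nonunits R"
    and const: "coeff (coeff F 0) 1 \<notin> nonunits R"
  shows "irreducible F"
proof -
  let ?J = "nonunits R"
  note JR = prime_ideal_nonunits[OF R]
  define P where "P = extend_by_var R ?J"
  have P: "prime_ideal_of (coeffs_in R) P"
    unfolding P_def by (rule prime_ideal_extend_by_var[OF JR])
  have main: "degree A = 0 \<or> degree B = 0"
    if AB: "A * B = F" "lead_coeff A = 1" "lead_coeff B = 1" for A B
  proof -
    have A: "A \<in> coeffs_in (coeffs_in R)"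
      using gauss_lemma_monic[OF R, of A B] AB F by auto
    have B: "B \<in> coeffs_in (coeffs_in R)"
      using gauss_lemma_monic[OF R, of B A] AB F by (auto simp: mult.commute)
    have low': "coeff (A * B) i \<in> P" if "i < degree (A * B)" for i
      using low[of i] that F AB by (auto simp: P_def extend_by_var_def coeffs_in_def)
    have lead': "lead_coeff (A * B) \<notin> P"
      using monic AB prime_ideal_ofD(5)[OF P] by simp
    have "coeff A 0 \<notin> P \<or> coeff B 0 \<notin> P"
    proof (rule ccontr)
      assume *: "\<not> ?thesis"
      have "coeff (coeff F 0) 1 = coeff (coeff A 0 * coeff B 0) 1"
        using AB by (auto simp: coeff_mult)
      also have "\<dots> = coeff (coeff A 0) 0 * coeff (coeff B 0) 1 + coeff (coeff A 0) 1 * coeff (coeff B 0) 0"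
        by (simp add: coeff_mult)
      also have "\<dots> \<in> ?J"
        using * A B
        by (intro prime_ideal_ofD(6,7,8)[OF JR]) (auto simp: P_def extend_by_var_def coeffs_in_def)
      finally show False using const by simp
    qed
    then show ?thesis
    proof
      assume "coeff A 0 \<notin> P"
      then show ?thesis
        using degree_cofactor[OF P B A] low' lead' by (auto simp: mult.commute)
    next
      assume "coeff B 0 \<notin> P"
      then show ?thesis
        using degree_cofactor[OF P A B] low' lead' by auto
    qed
  qed
  show ?thesis
  proof (rule irreducibleI)
    show "F \<noteq> 0" using deg by auto
    show "\<not> is_unit F"
      using deg by (auto simp: is_unit_poly_iff)
  next
    fix A B assume F_AB: "F = A * B"
    have l: "lead_coeff A * lead_coeff B = 1"
      using monic F_AB by (simp add: lead_coeff_mult)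
    have nz: "A \<noteq> 0" "B \<noteq> 0"
      using l by auto
    define A' B' where "A' = smult (lead_coeff B) A" and "B' = smult (lead_coeff A) B"
    have "A' * B' = F" "lead_coeff A' = 1" "lead_coeff B' = 1"
      using l F_AB nz by (simp_all add: A'_def B'_def mult.commute)
    then have "degree A' = 0 \<or> degree B' = 0"
      by (rule main)
    then have "degree A = 0 \<or> degree B = 0"
      using nz by (simp add: A'_def B'_def)
    then show "is_unit A \<or> is_unit B"
    proof
      assume "degree A = 0"
      then obtain a where "A = [:a:]" by (auto elim: degree_eq_zeroE)
      with l show ?thesis
        by (auto simp: is_unit_const_poly_iff intro!: dvdI[of 1 a "lead_coeff B"])
    next
      assume "degree B = 0"
      then obtain a where "B = [:a:]" by (auto elim: degree_eq_zeroE)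
      with l show ?thesis
        by (auto simp: is_unit_const_poly_iff mult.commute intro!: dvdI[of 1 a "lead_coeff A"])
    qed
  qed
qed

section \<open>Zeros of polynomials in two variables\<close>

text \<open>In a polynomial in two variables, \<open>t\<close> always denotes the inner and \<open>c\<close> the outer variable.\<close>

definition eval2 :: "'a::comm_ring_1 poly poly \<Rightarrow> 'a \<Rightarrow> 'a \<Rightarrow> 'a" where
  "eval2 F t c = poly (poly F [:c:]) t"

lemma eval2_simps [simp]:
  "eval2 0 t c = 0" "eval2 1 t c = 1"
  "eval2 (F + G) t c = eval2 F t c + eval2 G t c"
  "eval2 (F - G) t c = eval2 F t c - eval2 G t c"
  "eval2 (F * G) t c = eval2 F t c * eval2 G t c"
  "eval2 (F ^ n) t c = eval2 F t c ^ n"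
  "eval2 (pCons q F) t c = poly q t + c * eval2 F t c"
  "eval2 (smult q F) t c = poly q t * eval2 F t c"
  by (simp_all add: eval2_def)

lemma eval2_sum [simp]: "eval2 (sum f A) t c = (\<Sum>i\<in>A. eval2 (f i) t c)"
  by (simp add: eval2_def poly_sum)

lemma eval2_eq_poly_map_poly: "eval2 F t c = poly (map_poly (\<lambda>q. poly q t) F) c"
  by (induction F) (simp_all add: map_poly_pCons)

lemma monic_has_zero:
  fixes F :: "complex poly poly"
  assumes "lead_coeff F = 1" "0 < degree F"
  shows "\<exists>c. eval2 F t c = 0"
proof -
  let ?f = "map_poly (\<lambda>q. poly q t) F"
  have "coeff ?f (degree F) = 1"
    using assms by (simp add: coeff_map_poly)
  then have "degree F \<le> degree ?f"
    by (intro le_degree) auto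
  then have "\<not> constant (poly ?f)"
    using assms by (simp add: constant_degree)
  then show ?thesis
    using fundamental_theorem_of_algebra by (auto simp: eval2_eq_poly_map_poly)
qed

text \<open>Pseudo-division shows that an element of minimal degree in the ideal generated by \<open>F\<close>
  and \<open>Q\<close> divides a multiple of \<open>F\<close> and a multiple of \<open>Q\<close> by constants from the inner
  polynomial ring. Either it is such a constant itself, and then \<open>F\<close> and \<open>Q\<close> have no common
  zeros over most values of the inner variable, or the prime \<open>F\<close> divides it.\<close>

lemma nullstellensatz_two_variables:
  fixes F Q :: "complex poly poly"
  assumes F: "prime_elem F" "lead_coeff F = 1" "0 < degree F"
    and zeros: "\<And>t c. eval2 F t c = 0 \<Longrightarrow> eval2 Q t c = 0"
  shows "F dvd Q"
proof -
  define I where "I = {U * F + W * Q | U W. True}"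
  have IF: "F \<in> I" "Q \<in> I"
    unfolding I_def mem_Collect_eq
    by (rule exI[of _ 1], rule exI[of _ 0], simp) (rule exI[of _ 0], rule exI[of _ 1], simp)
  have Idiff: "smult a A - B * C \<in> I" if AB: "A \<in> I" "B \<in> I" for a A B C
  proof -
    obtain U W U' W' where "A = U * F + W * Q" "B = U' * F + W' * Q"
      using AB by (auto simp: I_def)
    then have "smult a A - B * C = (smult a U - U' * C) * F + (smult a W - W' * C) * Q"
      by (simp add: algebra_simps smult_add_right)
    then show ?thesis
      unfolding I_def by blast
  qed
  have F0: "F \<noteq> 0" using F by auto
  define M where "M = arg_min degree (\<lambda>A. A \<in> I \<and> A \<noteq> 0)"
  have "M \<in> I \<and> M \<noteq> 0"
    unfolding M_def by (rule arg_min_natI[of _ F]) (use IF F0 in auto)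
  then have M: "M \<in> I" "M \<noteq> 0" by auto
  have min: "degree M \<le> degree A" if "A \<in> I" "A \<noteq> 0" for A
    unfolding M_def by (rule arg_min_nat_le) (use that in auto)
  have div: "\<exists>a q. a \<noteq> 0 \<and> smult a A = M * q" if A: "A \<in> I" for A
  proof -
    obtain a q where a: "a \<noteq> 0" "smult a A = M * q + pseudo_mod A M"
      using pseudo_mod(1)[OF M(2)] by metis
    have "pseudo_mod A M = smult a A - M * q"
      using a by simp
    then have "pseudo_mod A M \<in> I"
      using Idiff A M by simp
    then have "pseudo_mod A M = 0"
      using min pseudo_mod(2)[OF M(2), of A] by (meson not_le)
    with a show ?thesis by auto
  qed
  show ?thesis
  proof (cases "degree M = 0")
    case True
    then obtain m where m: "M = [:m:]" by (auto elim: degree_eq_zeroE)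
    then have "m \<noteq> 0" using M by simp
    then have "finite {t. poly m t = 0}"
      by (rule poly_roots_finite)
    then obtain t where t: "poly m t \<noteq> 0"
      using infinite_UNIV_char_0[where ?'a = complex] by (metis (mono_tags) UNIV_eq_I mem_Collect_eq)
    obtain c where c: "eval2 F t c = 0"
      using monic_has_zero[OF F(2,3)] by blast
    obtain U W where "M = U * F + W * Q"
      using M by (auto simp: I_def)
    then have "eval2 M t c = 0"
      using c zeros[OF c] by simp
    then show ?thesis
      using t m by simp
  next
    case False
    obtain a q where a: "a \<noteq> 0" "smult a F = M * q"
      using div[OF IF(1)] by blast
    obtain b r where b: "b \<noteq> 0" "smult b Q = M * r"
      using div[OF IF(2)] by blast
    have "F dvd M * q"
      using a by (metis dvd_smult dvd_refl)
    then have "F dvd M \<or> F dvd q"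
      using F prime_elem_dvd_mult_iff by blast
    moreover have "\<not> F dvd q"
    proof
      assume "F dvd q"
      then obtain q' where "q = F * q'" ..
      with a have "[:a:] * F = (M * q') * F" by (simp add: mult_ac)
      then have "M * q' = [:a:]"
        using F0 mult_right_cancel by metis
      then have "degree (M * q') = 0" "M * q' \<noteq> 0"
        using a by simp_all
      then show False
        using False by (simp add: degree_mult_eq)
    qed
    ultimately have "F dvd smult b Q"
      unfolding b by (blast intro: dvd_mult2)
    then have "F dvd [:b:] * Q"
      by simp
    moreover have "\<not> F dvd [:b:]"
      using F b by (auto dest: dvd_imp_degree_le)
    ultimately show ?thesis
      using F prime_elem_dvd_mult_iff by blast
  qed
qed

section \<open>The critical orbit as a sequence of polynomials\<close>

text \<open>In the coordinate centred at the marked critical point a polynomial of degree \<open>p\<close> has the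
  form \<open>f y = c + (\<Sum>j=2..p. e j * y ^ j)\<close>. The orbit of \<open>0\<close> is regarded as a sequence of
  polynomials in the critical value \<open>c\<close> over the ring of the coefficients \<open>e j\<close>. All of them are
  divisible by \<open>c\<close>, and \<open>orbit_quot\<close> is the quotient.\<close>

primrec orbit_quot :: "(nat \<Rightarrow> 'a::comm_ring_1) \<Rightarrow> nat \<Rightarrow> nat \<Rightarrow> 'a poly" where
  "orbit_quot e p 0 = 0"
| "orbit_quot e p (Suc l) = 1 + (\<Sum>j=2..p. smult (e j) ([:0, 1:] ^ (j - 1) * orbit_quot e p l ^ j))"

definition orbit_poly :: "(nat \<Rightarrow> 'a::comm_ring_1) \<Rightarrow> nat \<Rightarrow> nat \<Rightarrow> 'a poly" where
  "orbit_poly e p l = [:0, 1:] * orbit_quot e p l"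

text \<open>The divided difference of \<open>f\<close> at two consecutive points of the orbit, divided by \<open>c\<close>. The
  additional factor \<open>c\<close> is there because \<open>0\<close> is a critical point.\<close>

definition collision_poly :: "(nat \<Rightarrow> 'a::comm_ring_1) \<Rightarrow> nat \<Rightarrow> nat \<Rightarrow> 'a poly" where
  "collision_poly e p l = (\<Sum>j=2..p. smult (e j) ([:0, 1:] ^ (j - 2) *
     (\<Sum>i<j. orbit_quot e p l ^ (j - Suc i) * orbit_quot e p (Suc l) ^ i)))"

lemma orbit_poly_0 [simp]: "orbit_poly e p 0 = 0"
  by (simp add: orbit_poly_def)

lemma orbit_poly_Suc:
  "orbit_poly e p (Suc l) = [:0, 1:] + (\<Sum>j=2..p. smult (e j) (orbit_poly e p l ^ j))"
proof -
  have "[:0, 1:] * ([:0, 1:] ^ (j - 1) * y ^ j) = ([:0, 1:] * y) ^ j" if "j \<in> {2..p}"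
    for j and y :: "'a poly"
  proof -
    have "[:0, 1::'a:] ^ j = [:0, 1:] * [:0, 1:] ^ (j - 1)"
      using that by (simp flip: power_Suc)
    then show ?thesis
      by (simp only: power_mult_distrib mult.assoc)
  qed
  then show ?thesis
    unfolding orbit_poly_def orbit_quot.simps distrib_left mult_1_right sum_distrib_left
    by (intro arg_cong2[where f = "(+)"] sum.cong refl) (simp only: mult_smult_right)
qed

lemma orbit_quot_diff:
  "orbit_quot e p (Suc (Suc l)) - orbit_quot e p (Suc l) =
     (orbit_quot e p (Suc l) - orbit_quot e p l) * ([:0, 1:] * collision_poly e p l)"
proof -
  let ?y = "orbit_quot e p l" and ?z = "orbit_quot e p (Suc l)"
  have "orbit_quot e p (Suc (Suc l)) - ?z =
      (\<Sum>j=2..p. smult (e j) ([:0, 1:] ^ (j - 1) * (?z ^ j - ?y ^ j)))"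
    by (simp only: orbit_quot.simps(2)[of e p "Suc l"] orbit_quot.simps(2)[of e p l]
        add_diff_cancel_left sum_subtractf[symmetric] smult_diff_right[symmetric]
        right_diff_distrib[symmetric])
  also have "\<dots> = (\<Sum>j=2..p. (?z - ?y) * ([:0, 1:] * smult (e j) ([:0, 1:] ^ (j - 2) *
     (\<Sum>i<j. ?y ^ (j - Suc i) * ?z ^ i))))"
  proof (rule sum.cong[OF refl])
    fix j assume "j \<in> {2..p}"
    then have "j - 1 = Suc (j - 2)" by auto
    then have "[:0, 1::'a:] ^ (j - 1) = [:0, 1:] * [:0, 1:] ^ (j - 2)"
      by (simp only: power_Suc)
    then show "smult (e j) ([:0, 1:] ^ (j - 1) * (?z ^ j - ?y ^ j)) =
      (?z - ?y) * ([:0, 1:] * smult (e j) ([:0, 1:] ^ (j - 2) * (\<Sum>i<j. ?y ^ (j - Suc i) * ?z ^ i)))"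
      by (simp only: power_diff_sumr2[of ?z j ?y] mult_smult_right mult.assoc mult.left_commute)
  qed
  also have "\<dots> = (?z - ?y) * ([:0, 1:] * collision_poly e p l)"
    by (simp only: collision_poly_def sum_distrib_left)
  finally show ?thesis .
qed

lemma orbit_poly_diff:
  "orbit_poly e p (Suc (Suc l)) - orbit_poly e p (Suc l) =
     (orbit_poly e p (Suc l) - orbit_poly e p l) * ([:0, 1:] * collision_poly e p l)"
  unfolding orbit_poly_def right_diff_distrib[symmetric] orbit_quot_diff by (simp only: mult.assoc)

lemma orbit_poly_monic:
  fixes e :: "nat \<Rightarrow> 'a::idom"
  assumes p: "2 \<le> p" and e: "e p = 1"
  shows "degree (orbit_poly e p (Suc l)) = p ^ l \<and> lead_coeff (orbit_poly e p (Suc l)) = 1"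
proof (induction l)
  case 0
  have "(\<Sum>j=2..p. smult (e j) (orbit_poly e p 0 ^ j)) = 0"
    by (intro sum.neutral) (auto simp: power_0_left)
  then show ?case
    by (simp add: orbit_poly_Suc[of e p 0])
next
  case (Suc l)
  let ?X = "orbit_poly e p (Suc l)"
  let ?r = "[:0, 1:] + (\<Sum>j=2..<p. smult (e j) (?X ^ j))"
  have "orbit_poly e p (Suc (Suc l)) = ?r + ?X ^ p"
    using p e by (subst orbit_poly_Suc) (simp add: sum.last_plus atLeastLessThanSuc_atLeastAtMost[symmetric] add.assoc)
  moreover have "degree (?X ^ p) = p * p ^ l"
    using Suc by (subst degree_power_eq) auto
  moreover have "degree ?r < p * p ^ l"
  proof (rule degree_add_less)
    show "degree [:0, 1::'a:] < p * p ^ l"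
      using p mult_le_mono[of 2 p 1 "p ^ l"] by simp
    show "degree (\<Sum>j=2..<p. smult (e j) (?X ^ j)) < p * p ^ l"
    proof (rule degree_sum_less)
      fix j assume "j \<in> {2..<p}"
      then have "degree (smult (e j) (?X ^ j)) \<le> j * p ^ l"
        using Suc degree_smult_le[of "e j" "?X ^ j"] degree_power_le[of ?X j]
        by (simp add: mult.commute)
      also have "\<dots> < p * p ^ l"
        using \<open>j \<in> {2..<p}\<close> p by auto
      finally show "degree (smult (e j) (?X ^ j)) < p * p ^ l" .
    qed (use p in auto)
  qed
  moreover have "lead_coeff (?X ^ p) = 1"
    using Suc by (metis lead_coeff_power power_one)
  ultimately show ?case
    using degree_add_eq_right lead_coeff_add_le by (metis power_Suc)
qed

lemma orbit_poly_diff_monic: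
  fixes e :: "nat \<Rightarrow> 'a::idom"
  assumes p: "2 \<le> p" and e: "e p = 1"
  shows "degree (orbit_poly e p (Suc l) - orbit_poly e p l) = p ^ l \<and>
    lead_coeff (orbit_poly e p (Suc l) - orbit_poly e p l) = 1"
proof -
  have "degree (- orbit_poly e p l) < degree (orbit_poly e p (Suc l))"
  proof (cases l)
    case 0
    then show ?thesis
      using orbit_poly_monic[of p e l] p e by simp
  next
    case (Suc m)
    have "p ^ m < p ^ Suc m" using p by simp
    then show ?thesis
      using orbit_poly_monic[of p e l] orbit_poly_monic[of p e m] p e Suc by (simp del: power_Suc)
  qed
  then have "degree (- orbit_poly e p l + orbit_poly e p (Suc l)) = p ^ l"
    "lead_coeff (- orbit_poly e p l + orbit_poly e p (Suc l)) = 1"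
    using orbit_poly_monic[of p e l, OF p e] degree_add_eq_right lead_coeff_add_le by metis+
  then show ?thesis by simp
qed

lemma collision_poly_monic:
  fixes e :: "nat \<Rightarrow> 'a::idom"
  assumes p: "2 \<le> p" and e: "e p = 1"
  shows "degree (collision_poly e p l) = p ^ Suc l - p ^ l - 1" "lead_coeff (collision_poly e p l) = 1"
    "collision_poly e p l \<noteq> 0"
proof -
  let ?D = "orbit_poly e p (Suc l) - orbit_poly e p l" and ?F = "collision_poly e p l"
  have D: "degree ?D = p ^ l" "lead_coeff ?D = 1" "?D \<noteq> 0"
    using orbit_poly_diff_monic[of p e, OF p e, of l] by auto
  have P: "degree (?D * ([:0, 1:] * ?F)) = p ^ Suc l" "lead_coeff (?D * ([:0, 1:] * ?F)) = 1"
    using orbit_poly_diff_monic[of p e, OF p e, of "Suc l"] unfolding orbit_poly_diff by blast+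
  show F0: "?F \<noteq> 0"
    using P(2) by auto
  then have "degree (?D * ([:0, 1:] * ?F)) = p ^ l + (1 + degree ?F)"
    using D by (subst degree_mult_eq) (auto simp: degree_mult_eq)
  with P(1) show "degree ?F = p ^ Suc l - p ^ l - 1"
    by simp
  show "lead_coeff ?F = 1"
    using P(2) unfolding lead_coeff_mult D(2) by simp
qed

lemma orbit_quot_coeff_0: "coeff (orbit_quot e p (Suc l)) 0 = 1"
  by (simp add: poly_0_coeff_0[symmetric] poly_sum power_0_left)

lemma collision_poly_coeff_0:
  assumes "2 \<le> p"
  shows "coeff (collision_poly e p l) 0 = (if l = 0 then e 2 else 2 * e 2)"
proof -
  have Y: "poly (orbit_quot e p l) 0 = (if l = 0 then 0 else 1)" for l
    using orbit_quot_coeff_0[of e p "l - 1"] by (cases l) (auto simp: poly_0_coeff_0)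
  have "poly (collision_poly e p l) 0 = (\<Sum>j=2..p. e j * (0 ^ (j - 2) *
     (\<Sum>i<j. poly (orbit_quot e p l) 0 ^ (j - Suc i) * poly (orbit_quot e p (Suc l)) 0 ^ i)))"
    by (simp only: collision_poly_def poly_sum poly_smult poly_mult poly_power poly_pCons poly_0) simp
  also have "\<dots> = e 2 * (poly (orbit_quot e p l) 0 + 1)"
    using assms Y[of "Suc l"]
    by (subst sum.remove[of _ 2]) (auto simp: numeral_2_eq_2 power_0_left intro!: sum.neutral)
  finally show ?thesis
    using Y[of l] by (auto simp: poly_0_coeff_0)
qed

lemma orbit_quot_in_coeffs_in:
  assumes T: "subring T" and e: "\<And>j. 2 \<le> j \<Longrightarrow> j \<le> p \<Longrightarrow> e j \<in> T"
  shows "orbit_quot e p l \<in> coeffs_in T" "orbit_poly e p l \<in> coeffs_in T"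
    "collision_poly e p l \<in> coeffs_in T"
proof -
  note S = subring_coeffs_in[OF T]
  have X: "[:0, 1:] \<in> coeffs_in T"
    by (simp add: pCons_in_coeffs_in[of 0] const_in_coeffs_in subringD(1,2)[OF T])
  have sm: "smult a q \<in> coeffs_in T" if "a \<in> T" "q \<in> coeffs_in T" for a q
    using that subringD(4)[OF T] by (auto simp: coeffs_in_def)
  show Y: "orbit_quot e p l \<in> coeffs_in T" for l
    by (induction l)
      (auto intro!: subringD(1,2,4,6)[OF S] subring_sum[OF S] subring_power[OF S] sm X e simp del: mult_pCons_left)
  show "orbit_poly e p l \<in> coeffs_in T"
    unfolding orbit_poly_def by (intro subringD(4)[OF S] X Y)
  show "collision_poly e p l \<in> coeffs_in T"
    unfolding collision_poly_def
    by (intro subringD(4)[OF S] X Y subring_sum[OF S] sm subring_power[OF S] e) auto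
qed

text \<open>The binomial coefficients strictly between the ends of row \<open>p\<close> are divisible by \<open>p\<close>.\<close>

lemma freshman_dream:
  fixes x y :: "'a::comm_ring_1"
  assumes J: "prime_ideal_of T J" and xy: "x \<in> T" "y \<in> T" and p: "prime p" "of_nat p \<in> J"
  shows "(x + y) ^ p - x ^ p - y ^ p \<in> J"
proof -
  note D = prime_ideal_ofD[OF J]
  have "p > 0" using p prime_gt_0_nat by blast
  have "(x + y) ^ p = (\<Sum>k\<le>p. of_nat (p choose k) * x ^ k * y ^ (p - k))"
    by (rule binomial_ring)
  also have "{..p} = insert 0 (insert p {0<..<p})"
    using \<open>p > 0\<close> by auto
  also have "(\<Sum>k\<in>\<dots>. of_nat (p choose k) * x ^ k * y ^ (p - k)) =
      y ^ p + (x ^ p + (\<Sum>k\<in>{0<..<p}. of_nat (p choose k) * x ^ k * y ^ (p - k)))"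
    using \<open>p > 0\<close> by simp
  finally have "(x + y) ^ p - x ^ p - y ^ p = (\<Sum>k\<in>{0<..<p}. of_nat (p choose k) * x ^ k * y ^ (p - k))"
    by simp
  also have "\<dots> \<in> J"
  proof (rule prime_ideal_sum[OF J])
    fix k assume k: "k \<in> {0<..<p}"
    then have "p dvd p choose k"
      using p \<open>p > 0\<close> by (intro dvd_choose_prime) auto
    then obtain m where "p choose k = p * m" ..
    then have "of_nat (p choose k) = of_nat p * (of_nat m :: 'a)"
      by simp
    also have "\<dots> \<in> J"
      by (intro D(8) p subring_of_nat D(1))
    finally show "of_nat (p choose k) * x ^ k * y ^ (p - k) \<in> J"
      by (intro D(8) subring_power D(1) xy)
  qed
  finally show ?thesis .
qed

text \<open>Modulo a prime ideal that contains \<open>p\<close> and all \<open>e j\<close> except the leading one, \<open>f\<close> is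
  \<open>y ^ p + c\<close> and the difference of consecutive points of the orbit is raised to the \<open>p\<close>-th power
  in each step.\<close>

lemma orbit_poly_diff_reduction:
  fixes e :: "nat \<Rightarrow> 'a::idom"
  assumes J: "prime_ideal_of T J" and p: "prime p" "of_nat p \<in> J"
    and e: "e p = 1" "\<And>j. 2 \<le> j \<Longrightarrow> j < p \<Longrightarrow> e j \<in> J"
  shows "orbit_poly e p (Suc l) - orbit_poly e p l - [:0, 1:] ^ (p ^ l) \<in> coeffs_in J"
proof (induction l)
  case 0
  have "(\<Sum>j=2..p. smult (e j) (orbit_poly e p 0 ^ j)) = 0"
    by (intro sum.neutral) (auto simp: power_0_left)
  then show ?case
    using prime_ideal_ofD(4)[OF J] by (simp add: orbit_poly_Suc[of e p 0] coeffs_in_def)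
next
  case (Suc l)
  note Jp = prime_ideal_coeffs_in[OF J]
  note D = prime_ideal_ofD[OF Jp]
  have p2: "2 \<le> p" using p prime_ge_2_nat by blast
  have eT: "e j \<in> T" if "2 \<le> j" "j \<le> p" for j
    using that e prime_ideal_ofD(1,3)[OF J] subringD(1)[of T] by (cases "j = p") auto
  have XT: "orbit_poly e p l \<in> coeffs_in T" for l
    using orbit_quot_in_coeffs_in[OF prime_ideal_ofD(1)[OF J]] eT by blast
  have cT: "[:0, 1:] ^ n \<in> coeffs_in T" for n
    by (intro subring_power D(1))
      (simp add: pCons_in_coeffs_in[of 0] const_in_coeffs_in subringD(1,2)[OF prime_ideal_ofD(1)[OF J]])
  have pJ: "(of_nat p :: 'a poly) \<in> coeffs_in J"
    using p prime_ideal_ofD(4)[OF J] by (simp add: of_nat_poly const_in_coeffs_in)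
  let ?X = "orbit_poly e p l" and ?Z = "orbit_poly e p (Suc l)"
  let ?c = "[:0, 1::'a:] ^ (p ^ l)"
  have split: "(\<Sum>j=2..p. smult (e j) (X ^ j)) = (\<Sum>j=2..<p. smult (e j) (X ^ j)) + X ^ p" for X
    using p2 e by (simp add: sum.last_plus atLeastLessThanSuc_atLeastAtMost[symmetric] add.commute)
  have 1: "(\<Sum>j=2..<p. smult (e j) (X ^ j)) \<in> coeffs_in J" if "X \<in> coeffs_in T" for X
  proof (rule prime_ideal_sum[OF Jp])
    fix j assume "j \<in> {2..<p}"
    then have "[:e j:] \<in> coeffs_in J"
      using e prime_ideal_ofD(4)[OF J] by (simp add: const_in_coeffs_in)
    then have "[:e j:] * X ^ j \<in> coeffs_in J"
      by (intro D(8) subring_power D(1) that)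
    then show "smult (e j) (X ^ j) \<in> coeffs_in J" by simp
  qed
  have 2: "(?X + (?Z - ?X)) ^ p - ?X ^ p - (?Z - ?X) ^ p \<in> coeffs_in J"
    by (intro freshman_dream[OF Jp] p pJ XT subringD(3)[OF D(1)])
  have 3: "(?c + (?Z - ?X - ?c)) ^ p - ?c ^ p - (?Z - ?X - ?c) ^ p \<in> coeffs_in J"
    by (intro freshman_dream[OF Jp] p pJ XT cT subringD(3)[OF D(1)])
  have 4: "(?Z - ?X - ?c) ^ p \<in> coeffs_in J"
    using prime_ideal_power[OF Jp Suc] p2 by simp
  have "orbit_poly e p (Suc (Suc l)) - ?Z - [:0, 1:] ^ (p ^ Suc l) =
     ((\<Sum>j=2..<p. smult (e j) (?Z ^ j)) - (\<Sum>j=2..<p. smult (e j) (?X ^ j)))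
     + (((?X + (?Z - ?X)) ^ p - ?X ^ p - (?Z - ?X) ^ p)
     + (((?c + (?Z - ?X - ?c)) ^ p - ?c ^ p - (?Z - ?X - ?c) ^ p) + (?Z - ?X - ?c) ^ p))"
    by (simp only: orbit_poly_Suc[of e p "Suc l"] orbit_poly_Suc[of e p l] split power_Suc
        power_mult[symmetric] mult.commute[of p]) (simp add: algebra_simps)
  also have "\<dots> \<in> coeffs_in J"
    by (intro D(6,11) 1 2 3 4 XT)
  finally show ?case .
qed

text \<open>Hence \<open>c * c ^ (p ^ l) * collision_poly e p l\<close> is congruent to \<open>c ^ (p ^ Suc l)\<close>, and
  cancelling the power of \<open>c\<close> only shifts coefficients.\<close>

lemma collision_poly_reduction:
  fixes e :: "nat \<Rightarrow> 'a::idom"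
  assumes J: "prime_ideal_of T J" and p: "prime p" "of_nat p \<in> J"
    and e: "e p = 1" "\<And>j. 2 \<le> j \<Longrightarrow> j < p \<Longrightarrow> e j \<in> J"
    and i: "i < degree (collision_poly e p l)"
  shows "coeff (collision_poly e p l) i \<in> J"
proof -
  note Jp = prime_ideal_coeffs_in[OF J]
  note D = prime_ideal_ofD[OF Jp]
  have p2: "2 \<le> p" using p prime_ge_2_nat by blast
  have eT: "e j \<in> T" if "2 \<le> j" "j \<le> p" for j
    using that e prime_ideal_ofD(1,3)[OF J] subringD(1)[of T] by (cases "j = p") auto
  let ?F = "collision_poly e p l"
  let ?D = "\<lambda>l. orbit_poly e p (Suc l) - orbit_poly e p l"
  let ?c = "[:0, 1::'a:]"
  have FT: "?F \<in> coeffs_in T"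
    using orbit_quot_in_coeffs_in[OF prime_ideal_ofD(1)[OF J]] eT by blast
  have cT: "?c \<in> coeffs_in T"
    by (simp add: pCons_in_coeffs_in[of 0] const_in_coeffs_in subringD(1,2)[OF prime_ideal_ofD(1)[OF J]])
  have red: "?D l - ?c ^ (p ^ l) \<in> coeffs_in J" for l
    by (rule orbit_poly_diff_reduction[of T J p e, OF J p e])
  have "?c ^ Suc (p ^ l) * ?F - ?c ^ (p ^ Suc l) =
      (?D (Suc l) - ?c ^ (p ^ Suc l)) - (?D l - ?c ^ (p ^ l)) * (?c * ?F)"
    unfolding orbit_poly_diff[of e p l] by (simp only: algebra_simps power_Suc)
  also have "\<dots> \<in> coeffs_in J"
    by (intro D(11) D(8) red subringD(4)[OF D(1)] cT FT)
  finally have "coeff (?c ^ Suc (p ^ l) * ?F - ?c ^ (p ^ Suc l)) (i + Suc (p ^ l)) \<in> J"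
    by (simp add: coeffs_in_def del: power_Suc)
  moreover have cm: "?c ^ n = monom 1 n" for n
    by (simp add: monom_altdef)
  moreover have "i + Suc (p ^ l) < p ^ Suc l"
    using i collision_poly_monic(1)[of p e l, OF p2 e(1)] by simp
  ultimately show ?thesis
    by (simp add: coeff_monom_mult del: power_Suc)
qed

section \<open>Polynomials with prescribed critical points\<close>

text \<open>The coefficient of \<open>y ^ j\<close> in the monic polynomial of degree \<open>p\<close> with critical points
  \<open>0\<close> and \<open>b i\<close> for \<open>i \<in> {2..p-1}\<close>.\<close>

definition crit_coeff :: "nat \<Rightarrow> (nat \<Rightarrow> complex) \<Rightarrow> nat \<Rightarrow> complex" where
  "crit_coeff p b j = of_nat p / of_nat j * coeff (\<Prod>i=2..p-1. [:- b i, 1:]) (j - 2)"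

lemma poly_eq_from_pderiv:
  fixes f g :: "'a::{idom,semiring_char_0} poly"
  assumes "pderiv f = pderiv g" "poly f x = poly g x"
  shows "f = g"
proof -
  have "pderiv (f - g) = 0"
    using assms by (simp add: pderiv_diff)
  then obtain h where "f - g = [:h:]"
    using pderiv_iszero by blast
  moreover from this assms have "h = 0"
    by (metis diff_self poly_const_conv poly_diff poly_pCons mult_zero_right add.right_neutral poly_0)
  ultimately show ?thesis by simp
qed

lemma prod_linear_eq_elem_sym:
  fixes v :: "'i \<Rightarrow> complex"
  assumes "finite I"
  shows "(\<Prod>i\<in>I. [:- v i, 1:]) = (\<Sum>j\<le>card I. monom ((-1) ^ j * elem_sym I v j) (card I - j))"
proof -
  have "(\<Prod>i\<in>I. [:- v i, 1:]) = (\<Prod>i\<in>I. [:0, 1:] - [:v i:])"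
    by simp
  also have "\<dots> = (\<Sum>X\<in>Pow I. (-1) ^ card X * (\<Prod>i\<in>X. [:v i:]) * (\<Prod>i\<in>I - X. [:0, 1:]))"
    using assms by (rule prod_diff_conv_sum)
  also have "\<dots> = (\<Sum>X\<in>Pow I. monom ((-1) ^ card X * (\<Prod>i\<in>X. v i)) (card I - card X))"
  proof (rule sum.cong[OF refl])
    fix X assume "X \<in> Pow I"
    then have X: "card (I - X) = card I - card X"
      using assms by (simp add: card_Diff_subset finite_subset)
    have "(\<Prod>i\<in>X. [:v i:]) = [:\<Prod>i\<in>X. v i:]"
      by (induction X rule: infinite_finite_induct) (simp_all add: one_pCons)
    moreover have "(-1) ^ card X = [:(-1) ^ card X :: complex:]"
      by (metis of_int_1 of_int_minus of_int_power of_int_poly)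
    ultimately show "(-1) ^ card X * (\<Prod>i\<in>X. [:v i:]) * (\<Prod>i\<in>I - X. [:0, 1:]) =
      monom ((-1) ^ card X * (\<Prod>i\<in>X. v i)) (card I - card X)"
      by (simp add: X monom_altdef mult.commute)
  qed
  also have "\<dots> = (\<Sum>j\<le>card I. \<Sum>X | X \<in> Pow I \<and> card X = j. monom ((-1) ^ card X * (\<Prod>i\<in>X. v i)) (card I - card X))"
    by (rule sum.group[symmetric]) (use assms in \<open>auto intro: card_mono\<close>)
  also have "\<dots> = (\<Sum>j\<le>card I. monom ((-1) ^ j * elem_sym I v j) (card I - j))"
    by (intro sum.cong refl) (simp add: elem_sym_def monom_sum sum_distrib_left)
  finally show ?thesis .
qed

lemma smult_sum_right: "smult a (sum f A) = (\<Sum>i\<in>A. smult a (f i))"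
  by (induction A rule: infinite_finite_induct) (simp_all add: smult_add_right)

lemma pderiv_sum: "pderiv (sum f A) = (\<Sum>i\<in>A. pderiv (f i))"
  by (induction A rule: infinite_finite_induct) (simp_all add: pderiv_add)

text \<open>Vieta's formulas. The product on the right has no term of degree \<open>d - 2\<close> because the
  critical points sum to zero, in accordance with the missing term in \<open>param_poly\<close>.\<close>

lemma pderiv_param_poly:
  assumes d: "3 \<le> d" and v: "v \<in> param_space d"
  shows "pderiv (param_poly d v) = smult (of_nat d) (\<Prod>i=1..d-1. [:- v i, 1:])"
proof -
  let ?s = "elem_sym {1..d-1} v"
  have s0: "?s 0 = 1"
  proof -
    have "{J. J \<subseteq> {1..d-1} \<and> card J = 0} = {{}}"
      by (auto dest: finite_subset)
    then show ?thesis by (simp add: elem_sym_def)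
  qed
  have s1: "?s 1 = 0"
  proof -
    have "{J. J \<subseteq> {1..d-1} \<and> card J = 1} = (\<lambda>i. {i}) ` {1..d-1}"
      by (auto simp: card_1_singleton_iff)
    then have "?s 1 = (\<Sum>i=1..d-1. v i)"
      by (simp add: elem_sym_def sum.reindex)
    then show ?thesis using v by (simp add: param_space_def)
  qed
  have "pderiv (param_poly d v) = monom (of_nat d) (d - 1)
      + (\<Sum>i=2..d-1. monom (of_nat (d - i) * param_coeff d v i) (d - i - 1))"
    by (simp add: param_poly_def pderiv_add pderiv_sum pderiv_monom pderiv_pCons)
  also have "\<dots> = (\<Sum>j\<le>d-1. smult (of_nat d) (monom ((-1) ^ j * ?s j) (d - 1 - j)))"
  proof -
    have "{..d-1} = insert 0 (insert 1 {2..d-1})"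
      using d by auto
    moreover have "monom (of_nat (d - i) * param_coeff d v i) (d - i - 1) =
        smult (of_nat d) (monom ((-1) ^ i * ?s i) (d - 1 - i))" if "i \<in> {2..d-1}" for i
    proof -
      have "of_nat (d - i) \<noteq> (0::complex)" using that d by auto
      then show ?thesis
        by (simp add: param_coeff_def smult_monom diff_commute[of d i])
    qed
    ultimately show ?thesis
      using s0 s1 by (simp add: smult_monom)
  qed
  also have "\<dots> = smult (of_nat d) (\<Prod>i=1..d-1. [:- v i, 1:])"
    by (simp only: prod_linear_eq_elem_sym finite_atLeastAtMost smult_sum_right card_atLeastAtMost) simp
  finally show ?thesis .
qed

lemma poly_param_poly_crit:
  assumes "3 \<le> d"
  shows "poly (param_poly d v) (v 1) = v d"
  by (simp add: param_poly_def poly_sum poly_monom)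

lemma degree_param_poly:
  assumes "3 \<le> d"
  shows "degree (param_poly d v) = d"
proof -
  have "degree (\<Sum>i=2..d-1. monom (param_coeff d v i) (d - i)) < d"
    by (rule degree_sum_less) (use assms in \<open>auto intro: le_less_trans[OF degree_monom_le]\<close>)
  then have "degree ((\<Sum>i=2..d-1. monom (param_coeff d v i) (d - i))
     + [: - (v 1 ^ d) - (\<Sum>i=2..d-1. param_coeff d v i * v 1 ^ (d - i)) + v d :]) < d"
    using assms by (intro degree_add_less) auto
  then show ?thesis
    by (simp only: param_poly_def add.assoc degree_add_eq_left degree_monom_eq one_neq_zero)
      (simp add: degree_add_eq_left degree_monom_eq)
qed

text \<open>Both sides have the same derivative as functions of \<open>y\<close> and the same value at \<open>y = 0\<close>.\<close>

lemma poly_param_poly_expand: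
  assumes d: "3 \<le> d" and v: "v \<in> param_space d"
  shows "poly (param_poly d v) (v 1 + y) = v d + (\<Sum>j=2..d. crit_coeff d (\<lambda>i. v i - v 1) j * y ^ j)"
proof -
  let ?e = "crit_coeff d (\<lambda>i. v i - v 1)"
  let ?B = "\<Prod>i=2..d-1. [:- (v i - v 1), 1:]"
  define f where "f = [:v d:] + (\<Sum>j=2..d. monom (?e j) j)"
  define g where "g = param_poly d v \<circ>\<^sub>p [:v 1, 1:]"
  have deg: "degree ?B \<le> d - 2"
    by (rule order.trans[OF degree_prod_sum_le]) auto
  have "pderiv f = (\<Sum>j=2..d. monom (of_nat d * coeff ?B (j - 2)) (j - 1))"
    by (auto simp: f_def pderiv_add pderiv_sum pderiv_monom pderiv_pCons crit_coeff_def intro!: sum.cong)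
  also have "\<dots> = (\<Sum>j\<le>d-2. monom (of_nat d * coeff ?B j) (Suc j))"
  proof (rule sum.reindex_bij_witness[of _ "\<lambda>j. j + 2" "\<lambda>j. j - 2"])
    fix j assume "j \<in> {2..d}"
    then have "Suc (j - 2) = j - 1" by auto
    then show "monom (of_nat d * coeff ?B (j - 2)) (Suc (j - 2)) = monom (of_nat d * coeff ?B (j - 2)) (j - 1)"
      by simp
  qed (use d in auto)
  also have "\<dots> = smult (of_nat d) ([:0, 1:] * (\<Sum>j\<le>d-2. monom (coeff ?B j) j))"
    by (simp add: sum_distrib_left smult_sum_right smult_monom monom_Suc)
  also have "(\<Sum>j\<le>d-2. monom (coeff ?B j) j) = ?B"
    using deg by (rule poly_as_sum_of_monoms')
  finally have f': "pderiv f = smult (of_nat d) ([:0, 1:] * ?B)" .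
  have "{1..d-1} = insert 1 {2..d-1}" using d by auto
  then have "pderiv (param_poly d v) = smult (of_nat d) ([:- v 1, 1:] * (\<Prod>i=2..d-1. [:- v i, 1:]))"
    by (subst pderiv_param_poly[OF d v]) simp
  then have "pderiv g = smult (of_nat d) ([:- v 1, 1:] * (\<Prod>i=2..d-1. [:- v i, 1:])) \<circ>\<^sub>p [:v 1, 1:]"
    by (simp add: g_def pderiv_pcompose pderiv_pCons)
  also have "\<dots> = smult (of_nat d) ([:0, 1:] * ?B)"
    unfolding pcompose_smult pcompose_mult pcompose_prod by (simp add: pcompose_pCons)
  finally have "pderiv f = pderiv g"
    using f' by simp
  moreover have "poly f 0 = poly g 0"
    using d by (simp add: f_def g_def poly_sum poly_monom poly_pcompose poly_param_poly_crit[unfolded One_nat_def] power_0_left sum.neutral)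
  ultimately have "f = g"
    by (rule poly_eq_from_pderiv)
  then have "poly g y = poly f y" by simp
  then show ?thesis
    by (simp add: f_def g_def poly_sum poly_monom poly_pcompose)
qed

section \<open>Curves in the parameter space\<close>

definition curve_point :: "nat \<Rightarrow> (nat \<Rightarrow> complex poly poly) \<Rightarrow> complex \<Rightarrow> complex \<Rightarrow> nat \<Rightarrow> complex" where
  "curve_point p \<Gamma> t c = (\<lambda>i\<in>{1..p}. eval2 (\<Gamma> i) t c)"

text \<open>The critical points are the given functions of \<open>t\<close> relative to the marked one, and the
  critical value relative to the marked critical point is \<open>c\<close>. The marked critical point is
  determined by the condition that the sum of all critical points vanishes.\<close>

definition crit_curve :: "nat \<Rightarrow> (nat \<Rightarrow> complex poly) \<Rightarrow> nat \<Rightarrow> complex poly poly" where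
  "crit_curve p b = (let a = smult (- 1 / of_nat (p - 1)) (\<Sum>i=2..p-1. b i) in
     (\<lambda>i. if i = 1 then [:a:] else if i = p then [:a, 1:] else [:a + b i:]))"

definition coeff_curve :: "nat \<Rightarrow> (nat \<Rightarrow> complex poly) \<Rightarrow> nat \<Rightarrow> complex poly" where
  "coeff_curve p b j =
     smult (of_nat p / of_nat j) (coeff (\<Prod>i=2..p-1. [:- b i, 1:]) (j - 2))"

lemma poly_coeff_prod_linear:
  fixes b :: "'i \<Rightarrow> complex poly"
  shows "poly (coeff (\<Prod>i\<in>A. [:- b i, 1:]) n) t = coeff (\<Prod>i\<in>A. [:- poly (b i) t, 1:]) n"
proof (induction A arbitrary: n rule: infinite_finite_induct)
  case (insert x A)
  then show ?case by (cases n) simp_all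
qed simp_all

lemma poly_coeff_curve: "poly (coeff_curve p b j) t = crit_coeff p (\<lambda>i. poly (b i) t) j"
  by (simp add: coeff_curve_def crit_coeff_def poly_coeff_prod_linear)

lemma crit_coeff_cong: "(\<And>i. i \<in> {2..p-1} \<Longrightarrow> b i = b' i) \<Longrightarrow> crit_coeff p b j = crit_coeff p b' j"
  unfolding crit_coeff_def by (metis (no_types, lifting) prod.cong)

context
  fixes p :: nat and b :: "nat \<Rightarrow> complex poly" and t c :: complex
  assumes p: "3 \<le> p"
begin

abbreviation "pt \<equiv> curve_point p (crit_curve p b) t c"

lemma curve_point_diff:
  shows "i \<in> {2..p-1} \<Longrightarrow> pt i - pt 1 = poly (b i) t"
    and "pt p - pt 1 = c"
  using p by (auto simp: curve_point_def crit_curve_def Let_def)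

lemma curve_point_in_param_space: "pt \<in> param_space p"
proof -
  have "{1..p-1} = insert 1 {2..p-1}" using p by auto
  then have "(\<Sum>i=1..p-1. pt i) = pt 1 + (\<Sum>i=2..p-1. pt i)"
    by simp
  also have "(\<Sum>i=2..p-1. pt i) = (\<Sum>i=2..p-1. pt 1 + poly (b i) t)"
    using curve_point_diff(1) by (intro sum.cong refl) (simp add: algebra_simps)
  also have "pt 1 + \<dots> = of_nat (p - 1) * pt 1 + (\<Sum>i=2..p-1. poly (b i) t)"
    using p by (simp add: sum.distrib of_nat_diff algebra_simps)
  also have "pt 1 = - 1 / of_nat (p - 1) * (\<Sum>i=2..p-1. poly (b i) t)"
    using p by (simp add: curve_point_def crit_curve_def Let_def poly_sum)
  also have "of_nat (p - 1) * \<dots> + (\<Sum>i=2..p-1. poly (b i) t) = 0"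
    using p by simp
  finally show ?thesis
    by (auto simp: param_space_def affine_space_def curve_point_def)
qed

lemma orbit_curve_point:
  "(poly (param_poly p pt) ^^ l) (pt 1) = pt 1 + eval2 (orbit_poly (coeff_curve p b) p l) t c"
proof (induction l)
  case (Suc l)
  let ?y = "eval2 (orbit_poly (coeff_curve p b) p l) t c"
  have "(poly (param_poly p pt) ^^ Suc l) (pt 1) = poly (param_poly p pt) (pt 1 + ?y)"
    using Suc by simp
  also have "\<dots> = pt p + (\<Sum>j=2..p. crit_coeff p (\<lambda>i. pt i - pt 1) j * ?y ^ j)"
    by (rule poly_param_poly_expand[OF p curve_point_in_param_space])
  also have "(\<Sum>j=2..p. crit_coeff p (\<lambda>i. pt i - pt 1) j * ?y ^ j) =
     (\<Sum>j=2..p. poly (coeff_curve p b j) t * ?y ^ j)"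
    unfolding poly_coeff_curve using curve_point_diff(1)
    by (intro sum.cong refl arg_cong2[where f = "(*)"] crit_coeff_cong) auto
  also have "pt p + \<dots> = pt 1 + eval2 (orbit_poly (coeff_curve p b) p (Suc l)) t c"
    using curve_point_diff(2) by (simp add: orbit_poly_Suc algebra_simps)
  finally show ?case .
qed simp

end

text \<open>A point of the parameter space is determined by the positions of the critical points and of
  the critical value relative to the marked critical point, since the sum of the critical points
  is known.\<close>

lemma curve_point_eq:
  assumes p: "3 \<le> p" and v: "v \<in> param_space p"
    and b: "\<And>i. i \<in> {2..p-1} \<Longrightarrow> poly (b i) t = v i - v 1"
  shows "curve_point p (crit_curve p b) t (v p - v 1) = v"
proof -
  let ?w = "curve_point p (crit_curve p b) t (v p - v 1)"
  have w: "?w \<in> param_space p"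
    by (rule curve_point_in_param_space[OF p])
  have diff: "?w i - ?w 1 = v i - v 1" if "i \<in> {1..p}" for i
  proof -
    have "i = 1 \<or> i \<in> {2..p-1} \<or> i = p"
      using that by auto
    then show ?thesis
      using b curve_point_diff(1)[OF p, of i b t "v p - v 1"]
        curve_point_diff(2)[OF p, of b t "v p - v 1"] by (elim disjE) simp_all
  qed
  have "(\<Sum>i=1..p-1. ?w i - v i) = (\<Sum>i=1..p-1. ?w 1 - v 1)"
    using diff by (intro sum.cong refl) (auto simp: algebra_simps)
  also have "\<dots> = of_nat (p - 1) * (?w 1 - v 1)"
    by simp
  finally have "of_nat (p - 1) * (?w 1 - v 1) = 0"
    using v w by (simp add: param_space_def sum_subtractf)
  moreover have "of_nat (p - 1) \<noteq> (0::complex)"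
    using p by simp
  ultimately have "?w 1 = v 1" by simp
  then have "?w i = v i" if "i \<in> {1..p}" for i
    using diff[OF that] by simp
  moreover have "?w \<in> extensional {1..p}" "v \<in> extensional {1..p}"
    using v w by (auto simp: param_space_def affine_space_def PiE_def)
  ultimately show ?thesis
    by (intro extensionalityI[of _ "{1..p}"]) auto
qed

lemma strictly_preperiodic_0: "strictly_preperiodic 0 1 g x \<longleftrightarrow> poly g x = x"
  by (auto simp: strictly_preperiodic_def)

text \<open>Once two consecutive points of the orbit agree, so do all later ones.\<close>

lemma strictly_preperiodic_Suc:
  "strictly_preperiodic (Suc k) 1 g x \<longleftrightarrow>
     (poly g ^^ Suc (Suc k)) x = (poly g ^^ Suc k) x \<and> (poly g ^^ Suc k) x \<noteq> (poly g ^^ k) x"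
proof -
  have "(poly g ^^ Suc k) x = (poly g ^^ k) x" if "l \<le> k" "(poly g ^^ Suc l) x = (poly g ^^ l) x" for l
    using that by (induction rule: dec_induct) auto
  then have *: "(poly g ^^ Suc l) x \<noteq> (poly g ^^ l) x"
    if "l \<le> k" "(poly g ^^ Suc k) x \<noteq> (poly g ^^ k) x" for l
    using that by blast
  have "strictly_preperiodic (Suc k) 1 g x \<longleftrightarrow>
     (poly g ^^ Suc (Suc k)) x = (poly g ^^ Suc k) x \<and> (\<forall>l\<le>k. (poly g ^^ Suc l) x \<noteq> (poly g ^^ l) x)"
  proof -
    have "l \<le> Suc k \<and> 1 \<le> m \<and> m \<le> 1 \<and> (l, m) \<noteq> (Suc k, 1) \<longleftrightarrow> l \<le> k \<and> m = 1" for l m :: nat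
      by auto
    then show ?thesis
      unfolding strictly_preperiodic_def by (simp del: funpow.simps)
  qed
  then show ?thesis
    using * by blast
qed

section \<open>Irreducible slices\<close>

lemma subring_of_int: "subring T \<Longrightarrow> of_int n \<in> T"
  by (cases n) (auto simp del: of_nat_Suc intro!: subringD(5) subring_of_nat)

lemma of_nat_coprime_unit:
  fixes R :: "'a::field_char_0 set"
  assumes R: "valuation_ring R" and p: "prime p" "of_nat p \<in> nonunits R" and j: "\<not> p dvd j"
  shows "of_nat j \<notin> nonunits R" "inverse (of_nat j) \<in> R"
proof -
  note D = prime_ideal_ofD[OF prime_ideal_nonunits[OF R]]
  show *: "of_nat j \<notin> nonunits R"
  proof
    assume j': "of_nat j \<in> nonunits R"
    have "gcd (int p) (int j) = 1"
      using p j by (metis gcd_int_int_eq of_nat_1 prime_imp_coprime coprime_iff_gcd_eq_1)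
    then obtain u v where "u * int p + v * int j = 1"
      using bezout_int[of "int p" "int j"] by auto
    then have "of_int u * of_nat p + of_int v * of_nat j = (1 :: 'a)"
      by (metis of_int_1 of_int_add of_int_mult of_int_of_nat_eq)
    moreover have "of_int u * of_nat p + of_int v * of_nat j \<in> nonunits R"
      by (intro D(6,7) p j' subring_of_int D(1))
    ultimately show False
      using D(5) by simp
  qed
  show "inverse (of_nat j) \<in> R"
    using * inverse_in_valuation_ring subring_of_nat[OF D(1)] by blast
qed

text \<open>The family of polynomials with coefficients \<open>e j\<close> depending on \<open>t\<close> reduces to \<open>y ^ p + c\<close>
  modulo the ideal generated by the maximal ideal and \<open>t\<close>, and \<open>e 2\<close> is not in the square of
  this ideal.\<close>

definition eisenstein_coeffs :: "nat \<Rightarrow> complex set \<Rightarrow> (nat \<Rightarrow> complex poly) \<Rightarrow> bool" where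
  "eisenstein_coeffs p R e \<longleftrightarrow> e p = 1 \<and>
     (\<forall>j. 2 \<le> j \<longrightarrow> j < p \<longrightarrow> e j \<in> extend_by_var R (nonunits R)) \<and>
     coeff (e 2) 1 \<notin> nonunits R"

text \<open>The coefficients are, up to units, those of \<open>p\<close> times \<open>\<Prod>i=2..p-1. y - b i\<close>. Only \<open>b 2\<close>
  has \<open>p\<close> in the denominator, and \<open>p * (y - b 2) = p * y - p * b 2\<close> vanishes modulo the ideal
  generated by the maximal ideal and \<open>t\<close>. The leading coefficient escapes
  because there \<open>p\<close> is cancelled by the denominator \<open>j = p\<close>.\<close>

lemma eisenstein_coeffs_coeff_curve:
  assumes R: "valuation_ring R" and p: "prime p" "odd p" "of_nat p \<in> nonunits R"
    and b2: "smult (of_nat p) (b 2) \<in> coeffs_in R" "coeff (b 2) 0 = 0"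
      "of_nat p * coeff (b 2) 1 = 1"
    and b: "\<And>i. i \<in> {3..p-1} \<Longrightarrow> b i \<in> coeffs_in R" "\<And>i. i \<in> {3..p-1} \<Longrightarrow> coeff (b i) 0 = 1"
  shows "eisenstein_coeffs p R (coeff_curve p b)"
proof -
  note JR = prime_ideal_nonunits[OF R]
  note DR = prime_ideal_ofD[OF JR]
  define P where "P = extend_by_var R (nonunits R)"
  have P: "prime_ideal_of (coeffs_in R) P"
    unfolding P_def by (rule prime_ideal_extend_by_var[OF JR])
  note D = prime_ideal_ofD[OF P]
  have p3: "3 \<le> p"
    using p by (metis One_nat_def Suc_leI eval_nat_numeral(3) le_neq_implies_less prime_ge_2_nat even_numeral)
  define B where "B = (\<Prod>i=3..p-1. [:- b i, 1:])"
  have "{2..p-1} = insert 2 {3..p-1}"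
    using p3 by auto
  then have split: "(\<Prod>i=2..p-1. [:- b i, 1:]) = [:- b 2, 1:] * B"
    by (simp add: B_def)
  have RT: "subring (coeffs_in (coeffs_in R))"
    by (intro subring_coeffs_in DR(1))
  have "[:- b i, 1:] \<in> coeffs_in (coeffs_in R)" if "i \<in> {3..p-1}" for i
    using b(1)[OF that] subringD[OF D(1)]
    by (simp add: pCons_in_coeffs_in[of "- b i"] const_in_coeffs_in)
  then have BR: "B \<in> coeffs_in (coeffs_in R)"
    unfolding B_def by (intro subring_prod RT)
  then have Bc: "coeff B n \<in> coeffs_in R" for n
    by (auto simp: coeffs_in_def)
  have pb2: "smult (of_nat p) (b 2) \<in> P"
    using b2 DR(4) by (simp add: P_def extend_by_var_def)
  have pP: "[:of_nat p:] \<in> P"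
    using p(3) DR(3)[OF p(3)] DR(1) subringD(2)[of R]
    by (simp add: P_def extend_by_var_def const_in_coeffs_in)
  have e: "coeff_curve p b j = [:inverse (of_nat j):] *
      ([:of_nat p:] * (if j = 2 then 0 else coeff B (j - 3)) - smult (of_nat p) (b 2) * coeff B (j - 2))"
    if "2 \<le> j" for j
  proof -
    have "coeff ([:- b 2, 1:] * B) (j - 2) = (if j = 2 then 0 else coeff B (j - 3)) - b 2 * coeff B (j - 2)"
      using that by (auto simp: coeff_pCons split: nat.splits) (metis Suc_diff_Suc diff_Suc_Suc less_Suc_eq_le numeral_2_eq_2 numeral_3_eq_3 order_less_le diff_Suc_1)
    then show ?thesis
      unfolding coeff_curve_def split by (simp add: smult_diff_right field_simps)
  qed
  have "coeff_curve p b p = 1"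
  proof -
    let ?L = "\<Prod>i=2..p-1. [:- b i, 1:]"
    have "degree ?L = p - 2"
      by (subst degree_prod_eq_sum_degree) auto
    moreover have "lead_coeff ?L = 1"
      by (simp add: lead_coeff_prod)
    ultimately show ?thesis
      using p3 by (simp add: coeff_curve_def)
  qed
  moreover have "coeff_curve p b j \<in> P" if j: "2 \<le> j" "j < p" for j
  proof -
    have "\<not> p dvd j"
      using j by (auto dest: dvd_imp_le)
    then have "inverse (of_nat j) \<in> R"
      using of_nat_coprime_unit[OF R p(1,3)] by blast
    then have "[:inverse (of_nat j):] \<in> coeffs_in R"
      using subringD(2)[OF DR(1)] by (simp add: const_in_coeffs_in)
    then show ?thesis
      unfolding e[OF j(1)]
      by (intro D(7) D(11) D(8) pP pb2 Bc) (use Bc subringD(2)[OF D(1)] in auto)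
  qed
  moreover have "coeff (coeff_curve p b 2) 1 \<notin> nonunits R"
  proof
    assume *: "coeff (coeff_curve p b 2) 1 \<in> nonunits R"
    let ?s = "(-1) ^ card {3..p-1} :: complex"
    have "coeff (coeff B 0) 0 = (\<Prod>i=3..p-1. coeff (- b i) 0)"
      by (simp add: B_def poly_0_coeff_0[symmetric] poly_prod)
    also have "\<dots> = (\<Prod>i=3..p-1. - 1)"
      using b(2) by (intro prod.cong) auto
    finally have B0: "coeff (coeff B 0) 0 = ?s"
      by simp
    have "coeff (coeff_curve p b 2) 1 = - inverse 2 * (of_nat p * coeff (b 2 * coeff B 0) 1)"
      by (subst e) simp_all
    also have "coeff (b 2 * coeff B 0) 1 = coeff (b 2) 1 * ?s"
      using b2 B0 by (simp add: coeff_mult)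
    also have "of_nat p * (coeff (b 2) 1 * ?s) = ?s"
      using b2(3) by (metis mult.assoc mult_1)
    finally have "coeff (coeff_curve p b 2) 1 = - inverse 2 * ?s" .
    moreover have "(- inverse 2 * ?s) * (- 2 * ?s) = 1"
      by (simp flip: power_mult_distrib)
    moreover have "- 2 * ?s \<in> R"
      using subring_of_nat[OF DR(1), of 2]
      by (intro subringD(4)[OF DR(1)] subring_power[OF DR(1)] subringD(5)[OF DR(1)] subringD(1)[OF DR(1)]) auto
    ultimately show False
      using * by (auto simp: nonunits_def)
  qed
  ultimately show ?thesis
    by (auto simp: eisenstein_coeffs_def P_def)
qed

text \<open>The constant term is \<open>e 2\<close> or \<open>2 * e 2\<close>, and \<open>2\<close> is a unit of \<open>R\<close> since \<open>p\<close> is odd.\<close>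

lemma irreducible_collision_poly:
  assumes R: "valuation_ring R" and p: "prime p" "odd p" "of_nat p \<in> nonunits R"
    and e: "eisenstein_coeffs p R e"
  shows "irreducible (collision_poly e p l)"
proof -
  note JR = prime_ideal_nonunits[OF R]
  note DR = prime_ideal_ofD[OF JR]
  define P where "P = extend_by_var R (nonunits R)"
  have P: "prime_ideal_of (coeffs_in R) P"
    unfolding P_def by (rule prime_ideal_extend_by_var[OF JR])
  note D = prime_ideal_ofD[OF P]
  have p2: "2 \<le> p" using p prime_ge_2_nat by blast
  have p3: "3 \<le> p"
    using p p2 by (metis One_nat_def Suc_leI eval_nat_numeral(3) le_neq_implies_less even_numeral)
  have eP: "e j \<in> P" if "2 \<le> j" "j < p" for j
    using e that by (auto simp: eisenstein_coeffs_def P_def)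
  have e1: "e p = 1"
    using e by (auto simp: eisenstein_coeffs_def)
  have eT: "e j \<in> coeffs_in R" if "2 \<le> j" "j \<le> p" for j
    using that eP[of j] D(3) subringD(1)[OF D(1)] e1 by (cases "j = p") auto
  have pP: "of_nat p \<in> P"
    using p(3) DR(3)[OF p(3)] subringD(2)[OF DR(1)]
    by (simp add: P_def extend_by_var_def const_in_coeffs_in of_nat_poly)
  note M = collision_poly_monic[of p e l, OF p2 e1]
  have "3 * p ^ l \<le> p * p ^ l" "0 < p ^ l"
    using p3 by auto
  then have "2 + p ^ l \<le> p ^ Suc l"
    by (simp only: power_Suc)
  then have deg: "0 < degree (collision_poly e p l)"
    unfolding M(1) by linarith
  show ?thesis
  proof (rule eisenstein_two_variables[OF R _ M(2) deg])
    show "collision_poly e p l \<in> coeffs_in (coeffs_in R)"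
      using orbit_quot_in_coeffs_in(3)[OF D(1)] eT by blast
    show "coeff (coeff (collision_poly e p l) i) 0 \<in> nonunits R"
      if "i < degree (collision_poly e p l)" for i
      using collision_poly_reduction[of _ P p e, OF P p(1) pP e1 eP that]
      by (auto simp: P_def extend_by_var_def)
    have "coeff (e 2) 1 \<notin> nonunits R" "coeff (e 2) 1 \<in> R"
      using e eT[of 2] p2 by (auto simp: eisenstein_coeffs_def coeffs_in_def)
    moreover have "\<not> p dvd 2"
      using p3 by (auto dest: dvd_imp_le)
    then have "of_nat 2 \<in> R - nonunits R"
      using of_nat_coprime_unit(1)[OF R p(1,3)] subring_of_nat[OF DR(1)] by blast
    ultimately have "of_nat 2 * coeff (e 2) 1 \<notin> nonunits R"
      using DR(9) by blast
    moreover have "coeff (2 * e 2) 1 = of_nat 2 * coeff (e 2) 1"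
      by (simp only: mult_2 coeff_add of_nat_numeral)
    ultimately show "coeff (coeff (collision_poly e p l) 0) 1 \<notin> nonunits R"
      using \<open>coeff (e 2) 1 \<notin> nonunits R\<close> unfolding collision_poly_coeff_0[OF p2] by metis
  qed
qed

text \<open>The element \<open>s\<close> is a common denominator of the values to be interpolated. At the parameters
  \<open>1 / s\<close> and \<open>- 1 / s\<close> the coefficients of higher order are multiplied by powers of \<open>1 / s\<close>,
  so that arbitrary prescribed values are reached with coefficients in the valuation ring.\<close>

lemma interpolating_curve:
  assumes R: "valuation_ring R" and p: "prime p" "odd p" "of_nat p \<in> nonunits R"
  shows "\<exists>b t1 t2. eisenstein_coeffs p R (coeff_curve p b) \<and>
    (\<forall>i\<in>{2..p-1}. poly (b i) t1 = u i \<and> poly (b i) t2 = (w i :: complex))"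
proof -
  note DR = prime_ideal_ofD[OF prime_ideal_nonunits[OF R]]
  note S = subringD[OF DR(1)]
  have p0: "of_nat p \<noteq> (0::complex)"
    using p(1) prime_gt_0_nat by fastforce
  define A where "A = insert 1 (u ` {2..p-1} \<union> w ` {2..p-1})"
  obtain s where s: "s \<noteq> 0" "(\<lambda>a. s * a) ` A \<subseteq> R"
    using valuation_ring_normalize_finite[OF R, of A] by (auto simp: A_def)
  have su: "s * u i \<in> R" and sw: "s * w i \<in> R" if "i \<in> {2..p-1}" for i
    using s that by (auto simp: A_def)
  have sR: "s \<in> R"
    using s by (auto simp: A_def)
  have "\<not> p dvd 2"
  proof
    assume "p dvd 2"
    then have "p \<le> 2" by (auto dest: dvd_imp_le)
    then have "p = 2" using prime_ge_2_nat[OF p(1)] by auto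
    then show False using p(2) by simp
  qed
  then have half: "inverse 2 \<in> R"
    using of_nat_coprime_unit(2)[OF R p(1,3), of 2] by simp
  have pR: "of_nat p \<in> R"
    using subring_of_nat[OF DR(1)] by blast
  define b where "b = (\<lambda>i. if i = 2 then
      smult (1 / of_nat p) [:0, 1, s ^ 2 * of_nat p * (u 2 + w 2) / 2, s ^ 3 * of_nat p * (u 2 - w 2) / 2 - s ^ 2:]
    else [:1, s * (u i - w i) / 2, s ^ 2 * (u i + w i - 2) / 2:])"
  have val: "poly (b i) (1 / s) = u i" "poly (b i) (- 1 / s) = w i" for i
    using s p0 by (auto simp: b_def field_simps power2_eq_square power3_eq_cube)
  have "eisenstein_coeffs p R (coeff_curve p b)"
  proof (rule eisenstein_coeffs_coeff_curve[OF R p])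
    have "2 \<in> {2..p-1}"
      using prime_ge_2_nat[OF p(1)] p(2) by (cases "p = 2") auto
    note su2 = su[OF this] and sw2 = sw[OF this]
    have "s ^ 2 * of_nat p * (u 2 + w 2) / 2 = s * of_nat p * (s * u 2 + s * w 2) * inverse 2"
      by (simp add: field_simps power2_eq_square)
    also have "\<dots> \<in> R"
      by (intro S(4) S(6) sR pR half su2 sw2)
    finally have c2: "s ^ 2 * of_nat p * (u 2 + w 2) / 2 \<in> R" .
    have "s ^ 3 * of_nat p * (u 2 - w 2) / 2 - s ^ 2 = s * s * of_nat p * (s * u 2 - s * w 2) * inverse 2 - s * s"
      by (simp add: field_simps power2_eq_square power3_eq_cube)
    also have "\<dots> \<in> R"
      by (intro S(3) S(4) sR pR half su2 sw2)
    finally have c3: "s ^ 3 * of_nat p * (u 2 - w 2) / 2 - s ^ 2 \<in> R" .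
    have "smult (of_nat p) (b 2) = [:0, 1, s ^ 2 * of_nat p * (u 2 + w 2) / 2, s ^ 3 * of_nat p * (u 2 - w 2) / 2 - s ^ 2:]"
      using p0 by (simp add: b_def)
    also have "\<dots> \<in> coeffs_in R"
      unfolding pCons_in_coeffs_in using c2 c3 S(1,2) by (simp add: coeffs_in_def)
    finally show "smult (of_nat p) (b 2) \<in> coeffs_in R" .
    show "coeff (b 2) 0 = 0" "of_nat p * coeff (b 2) 1 = 1"
      using p0 by (simp_all add: b_def)
  next
    fix i assume i: "i \<in> {3..p-1}"
    then have bi: "b i = [:1, s * (u i - w i) / 2, s ^ 2 * (u i + w i - 2) / 2:]"
      by (simp add: b_def)
    have i2: "i \<in> {2..p-1}" using i by auto
    have "s * (u i - w i) / 2 = (s * u i - s * w i) * inverse 2"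
      by (simp add: field_simps)
    also have "\<dots> \<in> R"
      by (intro S(3) S(4) sR half su[OF i2] sw[OF i2])
    finally have c1: "s * (u i - w i) / 2 \<in> R" .
    have "s ^ 2 * (u i + w i - 2) / 2 = s * (s * u i + s * w i) * inverse 2 - s * s"
      by (simp add: field_simps power2_eq_square)
    also have "\<dots> \<in> R"
      by (intro S(3) S(4) S(6) sR half su[OF i2] sw[OF i2])
    finally have c2: "s ^ 2 * (u i + w i - 2) / 2 \<in> R" .
    show "b i \<in> coeffs_in R"
      unfolding bi pCons_in_coeffs_in using c1 c2 S(1,2) by (simp add: coeffs_in_def)
    show "coeff (b i) 0 = 1"
      by (simp add: bi)
  qed
  then show ?thesis
    using val by blast
qed

text \<open>For \<open>k = 0\<close> the condition is \<open>c = 0\<close>. For \<open>k = Suc m\<close> the collision polynomial \<open>F\<close> must vanish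
  while the difference \<open>D\<close> of the last two points before the collision must not, which in
  particular excludes \<open>c = 0\<close>. The prime \<open>F\<close> does not divide \<open>D\<close>: it is not associated to \<open>c\<close>, as its
  constant term is not zero, and the degree of \<open>D / c\<close> is too small.\<close>

lemma irreducible_slice:
  assumes R: "valuation_ring R" and p: "prime p" "odd p" "of_nat p \<in> nonunits R"
    and b: "eisenstein_coeffs p R (coeff_curve p b)"
  shows "\<exists>F D. prime_elem F \<and> lead_coeff F = 1 \<and> 0 < degree F \<and> \<not> F dvd D \<and>
    (\<forall>t c. strictly_preperiodic k 1 (param_poly p (curve_point p (crit_curve p b) t c))
        (curve_point p (crit_curve p b) t c 1) \<longleftrightarrow> eval2 F t c = 0 \<and> eval2 D t c \<noteq> 0)"
proof -
  have p2: "2 \<le> p" using p prime_ge_2_nat by blast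
  have p3: "3 \<le> p"
    using p p2 by (cases "p = 2") auto
  let ?pt = "curve_point p (crit_curve p b)"
  define e where "e = coeff_curve p b"
  have orbit: "(poly (param_poly p (?pt t c)) ^^ l) (?pt t c 1) =
      ?pt t c 1 + eval2 (orbit_poly e p l) t c" for t c l
    unfolding e_def by (rule orbit_curve_point[OF p3])
  have dvd_c: "[:0, 1:] dvd G \<longleftrightarrow> coeff G 0 = 0" for G :: "complex poly poly"
    using poly_eq_0_iff_dvd[of G 0] by (simp add: poly_0_coeff_0)
  show ?thesis
  proof (cases k)
    case 0
    have "prime_elem ([:0, 1:] :: complex poly poly)"
      by (rule prime_elemI) (auto simp: dvd_c coeff_mult is_unit_poly_iff)
    moreover have "strictly_preperiodic k 1 (param_poly p (?pt t c)) (?pt t c 1) \<longleftrightarrow>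
        eval2 [:0, 1:] t c = 0 \<and> eval2 1 t c \<noteq> 0" for t c
      using orbit[of 1 t c] by (simp add: 0 strictly_preperiodic_0[unfolded One_nat_def] orbit_poly_Suc power_0_left sum.neutral)
    moreover have "\<not> [:0, 1:] dvd (1 :: complex poly poly)"
      by (simp add: dvd_c)
    ultimately show ?thesis
      by (intro exI[of _ "[:0, 1:]"] exI[of _ 1]) simp
  next
    case (Suc m)
    define F where "F = collision_poly e p m"
    define D where "D = orbit_poly e p (Suc m) - orbit_poly e p m"
    define Z where "Z = orbit_quot e p (Suc m) - orbit_quot e p m"
    have DZ: "D = [:0, 1:] * Z"
      by (simp only: D_def Z_def orbit_poly_def right_diff_distrib)
    have e1: "e p = 1" and e2: "coeff (e 2) 1 \<notin> nonunits R"
      using b by (auto simp: eisenstein_coeffs_def e_def)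
    have prime: "prime_elem F"
      unfolding F_def using irreducible_collision_poly[OF R p] b
      by (auto simp: e_def intro: irreducible_imp_prime_elem)
    note F = collision_poly_monic[of p e m, OF p2 e1, folded F_def]
    have "3 * p ^ m \<le> p * p ^ m" "0 < p ^ m"
      using p3 by auto
    then have pm: "3 * p ^ m \<le> p ^ Suc m" "0 < p ^ m"
      by (simp_all only: power_Suc)
    then have degF: "p ^ m \<le> degree F"
      unfolding F(1) by linarith
    have D1: "degree D = p ^ m" "lead_coeff D = 1"
      using orbit_poly_diff_monic[of p e m, OF p2 e1] unfolding D_def by blast+
    have "\<not> F dvd [:0, 1:]"
    proof
      assume "F dvd [:0, 1:]"
      then obtain G where G: "[:0, 1:] = F * G" ..
      have "coeff F 0 \<noteq> 0"
        using e2 prime_ideal_ofD(4)[OF prime_ideal_nonunits[OF R]] p2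
        by (auto simp: F_def collision_poly_coeff_0)
      moreover have "coeff F 0 * coeff G 0 = 0"
        using arg_cong[OF G, of "\<lambda>q. coeff q 0"] by (simp add: coeff_mult)
      ultimately obtain G' where "G = [:0, 1:] * G'"
        using dvd_c[of G] by auto
      then have "[:0, 1:] * (F * G') = [:0, 1:] * 1"
        using G by (simp only: mult.left_commute mult_1_right)
      then have "F * G' = 1"
        by (subst (asm) mult_left_cancel) auto
      then show False
        using prime by (metis dvd_triv_left prime_elem_not_unit)
    qed
    moreover have "\<not> F dvd Z"
    proof
      assume dvd: "F dvd Z"
      have "Z \<noteq> 0"
        using D1(2) DZ by auto
      then have "degree D = Suc (degree Z)"
        unfolding DZ by (subst degree_mult_eq) auto
      then show False
        using dvd_imp_degree_le[OF dvd \<open>Z \<noteq> 0\<close>] degF D1 by simp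
    qed
    ultimately have "\<not> F dvd D"
      unfolding DZ using prime prime_elem_dvd_mult_iff by blast
    moreover have "strictly_preperiodic k 1 (param_poly p (?pt t c)) (?pt t c 1) \<longleftrightarrow>
        eval2 F t c = 0 \<and> eval2 D t c \<noteq> 0" for t c
    proof -
      have "eval2 (orbit_poly e p (Suc (Suc m)) - orbit_poly e p (Suc m)) t c
          = eval2 D t c * (c * eval2 F t c)"
        unfolding orbit_poly_diff D_def F_def by simp
      moreover have "eval2 D t c = c * eval2 Z t c"
        by (simp add: DZ)
      moreover have "eval2 (orbit_poly e p (Suc m)) t c - eval2 (orbit_poly e p m) t c = eval2 D t c"
        by (simp add: D_def)
      ultimately show ?thesis
        unfolding Suc strictly_preperiodic_Suc orbit by auto
    qed
    moreover have "0 < degree F"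
      using degF pm by linarith
    ultimately show ?thesis
      using prime F(2) by blast
  qed
qed

section \<open>The locus in the parameter space\<close>

definition param_locus :: "nat \<Rightarrow> nat \<Rightarrow> (nat \<Rightarrow> complex) set" where
  "param_locus k p = {v \<in> param_space p. strictly_preperiodic k 1 (param_poly p v) (v 1)}"

lemma polynomial_fun_curve_point:
  assumes "polynomial_fun {1..p} q"
  shows "\<exists>Q. \<forall>t c. q (curve_point p \<Gamma> t c) = eval2 Q t c"
  using assms
proof induction
  case (const a)
  show ?case by (rule exI[of _ "[:[:a:]:]"]) simp
next
  case (coord i)
  then show ?case by (intro exI[of _ "\<Gamma> i"]) (auto simp: curve_point_def)
next
  case (add q r)
  then show ?case by (metis eval2_simps(3))
next
  case (mult q r)
  then show ?case by (metis eval2_simps(5))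
qed

lemma slice_through_points:
  assumes p: "prime p" "odd p" and u: "u \<in> param_space p" and w: "w \<in> param_space p"
  obtains \<Gamma> F D t1 c1 t2 c2 where "\<And>t c. curve_point p \<Gamma> t c \<in> param_space p"
    "curve_point p \<Gamma> t1 c1 = u" "curve_point p \<Gamma> t2 c2 = w"
    "prime_elem F" "lead_coeff F = 1" "0 < degree F" "\<not> F dvd D"
    "\<And>t c. curve_point p \<Gamma> t c \<in> param_locus k p \<longleftrightarrow> eval2 F t c = 0 \<and> eval2 D t c \<noteq> 0"
proof -
  have p3: "3 \<le> p"
    using p prime_ge_2_nat[OF p(1)] by (cases "p = 2") auto
  have "inverse (of_nat p) \<notin> (\<int> :: complex set)"
  proof
    assume "inverse (of_nat p) \<in> (\<int> :: complex set)"
    then obtain n where "inverse (of_nat p) = (of_int n :: complex)"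
      by (auto elim: Ints_cases)
    then have "of_int (int p * n) = (1 :: complex)"
      using p3 by (simp add: field_simps)
    then have "int p * n = 1"
      by (metis of_int_1 of_int_eq_iff)
    then show False
      using p3 by (auto simp: zmult_eq_1_iff)
  qed
  then obtain R where R: "valuation_ring R" "\<int> \<subseteq> R" "inverse (of_nat p) \<notin> (R :: complex set)"
    using exists_valuation_ring[OF subring_Ints] by (metis Ints_of_nat)
  have "of_nat p \<in> R"
    using R(2) Ints_of_nat by blast
  then have pR: "of_nat p \<in> nonunits R"
    using inverse_in_valuation_ring[of "of_nat p" R] R(3) by blast
  obtain b t1 t2 where b: "eisenstein_coeffs p R (coeff_curve p b)"
    "\<forall>i\<in>{2..p-1}. poly (b i) t1 = u i - u 1 \<and> poly (b i) t2 = w i - w 1"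
    using interpolating_curve[OF R(1) p pR, of "\<lambda>i. u i - u 1" "\<lambda>i. w i - w 1"] by auto
  obtain F D where FD: "prime_elem F" "lead_coeff F = 1" "0 < degree F" "\<not> F dvd D"
    "\<forall>t c. strictly_preperiodic k 1 (param_poly p (curve_point p (crit_curve p b) t c))
        (curve_point p (crit_curve p b) t c 1) \<longleftrightarrow> eval2 F t c = 0 \<and> eval2 D t c \<noteq> 0"
    using irreducible_slice[OF R(1) p pR b(1), of k] by blast
  have mem: "curve_point p (crit_curve p b) t c \<in> param_space p" for t c
    by (rule curve_point_in_param_space[OF p3])
  show ?thesis
  proof (rule that[OF mem _ _ FD(1-4)])
    show "curve_point p (crit_curve p b) t1 (u p - u 1) = u"
      "curve_point p (crit_curve p b) t2 (w p - w 1) = w"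
      using curve_point_eq[OF p3 u, of b t1] curve_point_eq[OF p3 w, of b t2] b(2) by blast+
    show "curve_point p (crit_curve p b) t c \<in> param_locus k p \<longleftrightarrow>
        eval2 F t c = 0 \<and> eval2 D t c \<noteq> 0" for t c
      using FD(5) mem by (simp add: param_locus_def)
  qed
qed

text \<open>Otherwise \<open>D\<close> would vanish at all zeros of \<open>F\<close> and hence be divisible by \<open>F\<close>.\<close>

lemma param_locus_nonempty:
  assumes p: "prime p" "odd p"
  shows "param_locus k p \<noteq> {}"
proof -
  have v: "(\<lambda>i\<in>{1..p}. 0) \<in> param_space p"
    by (auto simp: param_space_def affine_space_def intro!: sum.neutral)
  obtain \<Gamma> F D where F: "prime_elem F" "lead_coeff F = 1" "0 < degree F" "\<not> F dvd D"
    and locus: "\<And>t c. curve_point p \<Gamma> t c \<in> param_locus k p \<longleftrightarrow> eval2 F t c = 0 \<and> eval2 D t c \<noteq> 0"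
    using slice_through_points[OF p v v, of k] by metis
  then show ?thesis
    using nullstellensatz_two_variables[OF F(1-3), of D] by blast
qed

text \<open>On a slice through \<open>u\<close> and \<open>w\<close> the prime \<open>F\<close> divides the product of the restrictions of \<open>g\<close>
  and \<open>h\<close> with \<open>D\<close>, but it does not divide \<open>D\<close>.\<close>

lemma param_locus_irreducible:
  assumes p: "prime p" "odd p"
    and g: "polynomial_fun {1..p} g" and h: "polynomial_fun {1..p} h"
    and gh: "\<And>v. v \<in> param_locus k p \<Longrightarrow> g v = 0 \<or> h v = 0"
    and u: "u \<in> param_locus k p" and w: "w \<in> param_locus k p"
  shows "g u = 0 \<or> h w = 0"
proof -
  have uw: "u \<in> param_space p" "w \<in> param_space p"
    using u w by (auto simp: param_locus_def)
  obtain \<Gamma> F D t1 c1 t2 c2 where pts: "curve_point p \<Gamma> t1 c1 = u" "curve_point p \<Gamma> t2 c2 = w"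
    and F: "prime_elem F" "lead_coeff F = 1" "0 < degree F" "\<not> F dvd D"
    and locus: "\<And>t c. curve_point p \<Gamma> t c \<in> param_locus k p \<longleftrightarrow> eval2 F t c = 0 \<and> eval2 D t c \<noteq> 0"
    using slice_through_points[OF p uw, of k] by metis
  obtain G H where G: "\<And>t c. g (curve_point p \<Gamma> t c) = eval2 G t c"
    and H: "\<And>t c. h (curve_point p \<Gamma> t c) = eval2 H t c"
    using polynomial_fun_curve_point[OF g, of \<Gamma>] polynomial_fun_curve_point[OF h, of \<Gamma>] by metis
  have "eval2 (G * H * D) t c = 0" if "eval2 F t c = 0" for t c
    using gh[of "curve_point p \<Gamma> t c"] that locus[of t c] G[of t c] H[of t c] by auto
  then have "F dvd G * H * D"
    by (rule nullstellensatz_two_variables[OF F(1-3)])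
  then have "F dvd G \<or> F dvd H"
    using F(1,4) by (simp add: prime_elem_dvd_mult_iff)
  moreover have "eval2 F t1 c1 = 0" "eval2 F t2 c2 = 0"
    using locus[of t1 c1] locus[of t2 c2] pts u w by auto
  ultimately have "eval2 G t1 c1 = 0 \<or> eval2 H t2 c2 = 0"
    by (auto elim!: dvdE)
  then show ?thesis
    using G H pts by metis
qed

section \<open>Normal forms of marked polynomials\<close>

text \<open>Conjugation by \<open>h z = a * z + b\<close>, expressed without the inverse of \<open>h\<close>.\<close>

lemma affine_conj_iff:
  fixes f g :: "complex poly"
  assumes "a \<noteq> 0"
  shows "g = [:b, a:] \<circ>\<^sub>p f \<circ>\<^sub>p [:- b / a, 1 / a:] \<longleftrightarrow> (\<forall>z. poly g (a * z + b) = a * poly f z + b)"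
proof -
  have "g = [:b, a:] \<circ>\<^sub>p f \<circ>\<^sub>p [:- b / a, 1 / a:] \<longleftrightarrow>
      (\<forall>y. poly g y = a * poly f ((y - b) / a) + b)"
    unfolding poly_eq_poly_eq_iff[symmetric] fun_eq_iff
    by (simp add: poly_pcompose algebra_simps diff_divide_distrib)
  also have "\<dots> \<longleftrightarrow> (\<forall>z. poly g (a * z + b) = a * poly f z + b)"
  proof (intro iffI allI)
    fix z assume "\<forall>y. poly g y = a * poly f ((y - b) / a) + b"
    then have "poly g (a * z + b) = a * poly f ((a * z + b - b) / a) + b"
      by blast
    then show "poly g (a * z + b) = a * poly f z + b"
      using assms by simp
  next
    fix y assume "\<forall>z. poly g (a * z + b) = a * poly f z + b"
    then have "poly g (a * ((y - b) / a) + b) = a * poly f ((y - b) / a) + b"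
      by blast
    then show "poly g y = a * poly f ((y - b) / a) + b"
      using assms by simp
  qed
  finally show ?thesis .
qed

lemma conj_rel_iff:
  "((f, \<alpha>), (g, \<gamma>)) \<in> conj_rel d \<longleftrightarrow> (f, \<alpha>) \<in> marked_polys d \<and> (g, \<gamma>) \<in> marked_polys d \<and>
     (\<exists>a b. a \<noteq> 0 \<and> (\<forall>z. poly g (a * z + b) = a * poly f z + b) \<and> \<gamma> = a * \<alpha> + b)"
  unfolding conj_rel_def mem_Collect_eq prod.case by (metis affine_conj_iff)

lemma equiv_conj_rel: "equiv (marked_polys d) (conj_rel d)"
proof (rule equivI)
  show "conj_rel d \<subseteq> marked_polys d \<times> marked_polys d"
    by (auto simp: conj_rel_def)
  show "refl_on (marked_polys d) (conj_rel d)"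
  proof (rule refl_onI, clarify)
    fix f \<alpha> assume "(f, \<alpha>) \<in> marked_polys d"
    moreover have "1 \<noteq> (0::complex) \<and> (\<forall>z. poly f (1 * z + 0) = 1 * poly f z + 0) \<and> \<alpha> = 1 * \<alpha> + 0"
      by simp
    ultimately show "((f, \<alpha>), (f, \<alpha>)) \<in> conj_rel d"
      unfolding conj_rel_iff by blast
  qed
  show "sym (conj_rel d)"
  proof (rule symI, clarify)
    fix f \<alpha> g \<gamma> assume *: "((f, \<alpha>), (g, \<gamma>)) \<in> conj_rel d"
    then obtain a b where ab: "a \<noteq> 0" "\<And>z. poly g (a * z + b) = a * poly f z + b" "\<gamma> = a * \<alpha> + b"
      by (auto simp: conj_rel_iff)
    have "poly f (1 / a * z + - b / a) = 1 / a * poly g z + - b / a" for z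
    proof -
      have "a * (1 / a * z + - b / a) + b = z"
        using ab(1) by (simp add: distrib_left right_diff_distrib diff_divide_distrib add_divide_distrib)
      then have "poly g z = a * poly f (1 / a * z + - b / a) + b"
        using ab(2)[of "1 / a * z + - b / a"] by (simp only:)
      then have "1 / a * poly g z + - b / a = 1 / a * (a * poly f (1 / a * z + - b / a) + b) + - b / a"
        by (simp only:)
      also have "\<dots> = poly f (1 / a * z + - b / a)"
        using ab(1) by (simp add: distrib_left right_diff_distrib diff_divide_distrib add_divide_distrib)
      finally show ?thesis by (rule sym)
    qed
    moreover have "\<alpha> = 1 / a * \<gamma> + - b / a"
      unfolding ab(3) using ab(1) by (simp add: distrib_left right_diff_distrib diff_divide_distrib add_divide_distrib)
    moreover have "1 / a \<noteq> 0"
      using ab by simp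
    ultimately show "((g, \<gamma>), (f, \<alpha>)) \<in> conj_rel d"
      using * unfolding conj_rel_iff by blast
  qed
  show "trans (conj_rel d)"
  proof (rule transI, clarify)
    fix f \<alpha> g \<gamma> h \<eta>
    assume *: "((f, \<alpha>), (g, \<gamma>)) \<in> conj_rel d" "((g, \<gamma>), (h, \<eta>)) \<in> conj_rel d"
    then obtain a b a' b' where ab: "a \<noteq> 0" "\<And>z. poly g (a * z + b) = a * poly f z + b" "\<gamma> = a * \<alpha> + b"
      "a' \<noteq> 0" "\<And>z. poly h (a' * z + b') = a' * poly g z + b'" "\<eta> = a' * \<gamma> + b'"
      by (auto simp: conj_rel_iff)
    have "poly h (a' * a * z + (a' * b + b')) = a' * a * poly f z + (a' * b + b')" for z
      using ab(2)[of z] ab(5)[of "a * z + b"] by (simp add: algebra_simps)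
    moreover have "\<eta> = a' * a * \<alpha> + (a' * b + b')" "a' * a \<noteq> 0"
      using ab by (simp_all add: algebra_simps)
    ultimately show "((f, \<alpha>), (h, \<eta>)) \<in> conj_rel d"
      using * unfolding conj_rel_iff by blast
  qed
qed

lemma strictly_preperiodic_conj_rel:
  assumes "((f, \<alpha>), (g, \<gamma>)) \<in> conj_rel d"
  shows "strictly_preperiodic k n g \<gamma> \<longleftrightarrow> strictly_preperiodic k n f \<alpha>"
proof -
  obtain a b where ab: "a \<noteq> 0" "\<And>z. poly g (a * z + b) = a * poly f z + b" "\<gamma> = a * \<alpha> + b"
    using assms by (auto simp: conj_rel_iff)
  have "(poly g ^^ l) \<gamma> = a * (poly f ^^ l) \<alpha> + b" for l
    by (induction l) (simp_all add: ab(2,3))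
  then show ?thesis
    using ab(1) by (simp add: strictly_preperiodic_def)
qed

lemma param_poly_marked:
  assumes d: "3 \<le> d" and v: "v \<in> param_space d"
  shows "(param_poly d v, v 1) \<in> marked_polys d"
proof -
  have "1 \<in> {1..d-1}" using d by auto
  then have "(\<Prod>i=1..d-1. poly [:- v i, 1:] (v 1)) = 0"
    by (intro prod_zero) (auto intro!: bexI[of _ 1])
  then show ?thesis
    using degree_param_poly[OF d, of v] pderiv_param_poly[OF d v]
    by (simp add: marked_polys_def poly_prod)
qed

text \<open>Conjugate with \<open>z \<mapsto> a * z + b\<close>: the scaling makes the polynomial monic, the translation moves the barycentre of the critical
  points to \<open>0\<close>, and a polynomial is determined by its derivative and one of its values.\<close>

lemma exists_normal_form:
  assumes d: "3 \<le> d" and f: "(f, \<alpha>) \<in> marked_polys d"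
  shows "\<exists>v\<in>param_space d. ((f, \<alpha>), (param_poly d v, v 1)) \<in> conj_rel d"
proof -
  have deg: "degree f = d" and crit: "poly (pderiv f) \<alpha> = 0"
    using f by (auto simp: marked_polys_def)
  define c where "c = lead_coeff f"
  have "f \<noteq> 0" using deg d by auto
  then have c: "c \<noteq> 0" by (simp add: c_def)
  obtain q where q: "pderiv f = [:- \<alpha>, 1:] * q"
    using crit by (auto simp: poly_eq_0_iff_dvd)
  have "degree (pderiv f) = d - 1"
    using deg by (simp add: degree_pderiv)
  moreover from this have "q \<noteq> 0"
    using q d by auto
  ultimately have degq: "degree q = d - 2"
    using q by (simp add: degree_mult_eq del: mult_pCons_left)
  have "lead_coeff (pderiv f) = of_nat d * c"
    using d deg \<open>degree (pderiv f) = d - 1\<close> by (simp add: coeff_pderiv c_def of_nat_diff)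
  then have lq: "lead_coeff q = of_nat d * c"
    unfolding q lead_coeff_mult by simp
  obtain root where root: "smult (lead_coeff q) (\<Prod>i<degree q. [:- root i, 1:]) = q"
    using complex_poly_decompose' .
  define r where "r = (\<lambda>i. if i = 1 then \<alpha> else root (i - 2))"
  have "(\<Prod>i<d-2. [:- root i, 1:]) = (\<Prod>i=2..d-1. [:- r i, 1:])"
    by (rule prod.reindex_bij_witness[of _ "\<lambda>i. i - 2" "\<lambda>i. i + 2"]) (use d in \<open>auto simp: r_def\<close>)
  then have q': "q = smult (of_nat d * c) (\<Prod>i=2..d-1. [:- r i, 1:])"
    using root[unfolded lq, unfolded degq] by (simp only:)
  have "{1..d-1} = insert 1 {2..d-1}" using d by auto
  then have "(\<Prod>i=1..d-1. [:- r i, 1:]) = [:- r 1, 1:] * (\<Prod>i=2..d-1. [:- r i, 1:])"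
    by (simp del: mult_pCons_left)
  also have "r 1 = \<alpha>"
    by (simp add: r_def)
  finally have f': "pderiv f = smult (of_nat d * c) (\<Prod>i=1..d-1. [:- r i, 1:])"
    unfolding q by (subst q') (simp only: mult_smult_right)
  have "d - 1 \<noteq> 0" using d by simp
  then obtain a where a: "a ^ (d - 1) = c"
    using exists_complex_root[of "d - 1" c] by metis
  have a0: "a \<noteq> 0"
    using a c d by (auto simp: power_0_left)
  define b where "b = - a * (\<Sum>i=1..d-1. r i) / of_nat (d - 1)"
  define v where "v = (\<lambda>i\<in>{1..d}. if i = d then a * poly f \<alpha> + b else a * r i + b)"
  have vi: "v i = a * r i + b" if "i \<in> {1..d-1}" for i
    using that d by (auto simp: v_def)
  have "(\<Sum>i=1..d-1. v i) = (\<Sum>i=1..d-1. a * r i + b)"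
    using vi by (rule sum.cong[OF refl])
  also have "\<dots> = a * (\<Sum>i=1..d-1. r i) + of_nat (d - 1) * b"
    by (simp add: sum.distrib sum_distrib_left)
  also have "\<dots> = 0"
    using d by (simp add: b_def)
  finally have v: "v \<in> param_space d"
    by (auto simp: param_space_def affine_space_def v_def)
  have v1: "v 1 = a * \<alpha> + b"
    using vi[of 1] d by (simp add: r_def)
  have lin: "[:- v i, 1:] \<circ>\<^sub>p [:b, a:] = smult a [:- r i, 1:]" if "i \<in> {1..d-1}" for i
    using vi[OF that] by (simp add: pcompose_pCons)
  have lin': "(\<Prod>i=1..d-1. [:- v i, 1:] \<circ>\<^sub>p [:b, a:]) = (\<Prod>i=1..d-1. smult a [:- r i, 1:])"
    using lin by (rule prod.cong[OF refl])
  have "pderiv (param_poly d v \<circ>\<^sub>p [:b, a:]) =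
      smult a (smult (of_nat d) (\<Prod>i=1..d-1. smult a [:- r i, 1:]))"
    unfolding pderiv_pcompose pderiv_param_poly[OF d v] pcompose_smult pcompose_prod lin'
    by (simp add: pderiv_pCons mult.commute)
  also have "\<dots> = smult a (smult (of_nat d) (smult (a ^ (d - 1)) (\<Prod>i=1..d-1. [:- r i, 1:])))"
    by (simp only: prod_smult prod_constant card_atLeastAtMost diff_Suc_1)
  also have "\<dots> = pderiv (smult a f + [:b:])"
    by (simp add: f' a[unfolded One_nat_def] pderiv_add pderiv_smult pderiv_pCons)
  finally have "pderiv (param_poly d v \<circ>\<^sub>p [:b, a:]) = pderiv (smult a f + [:b:])" .
  moreover have "poly (param_poly d v \<circ>\<^sub>p [:b, a:]) \<alpha> = poly (smult a f + [:b:]) \<alpha>"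
  proof -
    have "poly (param_poly d v \<circ>\<^sub>p [:b, a:]) \<alpha> = poly (param_poly d v) (v 1)"
      by (simp add: poly_pcompose v1[unfolded One_nat_def] algebra_simps)
    also have "\<dots> = v d"
      by (rule poly_param_poly_crit[OF d])
    finally show ?thesis
      using d by (simp add: v_def)
  qed
  ultimately have eq: "param_poly d v \<circ>\<^sub>p [:b, a:] = smult a f + [:b:]"
    by (rule poly_eq_from_pderiv)
  have "poly (param_poly d v) (a * z + b) = a * poly f z + b" for z
    using arg_cong[OF eq, of "\<lambda>q. poly q z"] by (simp add: poly_pcompose algebra_simps)
  then have "((f, \<alpha>), (param_poly d v, v 1)) \<in> conj_rel d"
    unfolding conj_rel_iff using f param_poly_marked[OF d v] a0 v1 by blast
  then show ?thesis
    using v by blast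
qed

lemma preperiodic_locus_eq_image:
  assumes p: "3 \<le> p"
  shows "preperiodic_locus k 1 p = param_class p ` param_locus k p"
proof (intro equalityI subsetI)
  fix X assume "X \<in> preperiodic_locus k 1 p"
  then obtain f \<alpha> where X: "X = conj_rel p `` {(f, \<alpha>)}" "(f, \<alpha>) \<in> marked_polys p"
    "strictly_preperiodic k 1 f \<alpha>"
    by (auto simp: preperiodic_locus_def)
  obtain v where v: "v \<in> param_space p" "((f, \<alpha>), (param_poly p v, v 1)) \<in> conj_rel p"
    using exists_normal_form[OF p X(2)] by blast
  have "v \<in> param_locus k p"
    using v X(3) strictly_preperiodic_conj_rel[OF v(2), of k 1] by (simp add: param_locus_def)
  moreover have "X = param_class p v"
    unfolding X(1) param_class_def by (rule equiv_class_eq[OF equiv_conj_rel v(2)])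
  ultimately show "X \<in> param_class p ` param_locus k p"
    by blast
next
  fix X assume "X \<in> param_class p ` param_locus k p"
  then show "X \<in> preperiodic_locus k 1 p"
    using param_poly_marked[OF p]
    by (auto simp: preperiodic_locus_def param_class_def param_locus_def)
qed

section \<open>Irreducibility in the quotient topology\<close>

lemma topspace_zariski: "topspace (zariski_topology I) = affine_space I"
proof
  show "topspace (zariski_topology I) \<subseteq> affine_space I"
    unfolding topspace_def openin_zariski_topology by auto
  have "openin (zariski_topology I) (affine_space I)"
    unfolding openin_zariski_topology
    by (rule exI[of _ "{\<lambda>x. 1}"]) (auto simp: zero_locus_def intro: polynomial_fun.const)
  then show "affine_space I \<subseteq> topspace (zariski_topology I)"
    by (rule openin_subset)
qed

lemma topspace_param_space:
  "topspace (subtopology (zariski_topology {1..d}) (param_space d)) = param_space d"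
  by (auto simp: topspace_zariski param_space_def)

lemma topspace_moduli_topology:
  assumes "3 \<le> d"
  shows "topspace (moduli_topology d) = moduli_space d"
proof
  show "topspace (moduli_topology d) \<subseteq> moduli_space d"
    unfolding topspace_def moduli_topology_def openin_quotient_topology by auto
  have "param_class d v \<in> moduli_space d" if "v \<in> param_space d" for v
    using param_poly_marked[OF assms that] by (auto simp: moduli_space_def param_class_def intro: quotientI)
  then have "{v \<in> topspace (subtopology (zariski_topology {1..d}) (param_space d)).
      param_class d v \<in> moduli_space d} = topspace (subtopology (zariski_topology {1..d}) (param_space d))"
    by (auto simp: topspace_param_space)
  then have "openin (moduli_topology d) (moduli_space d)"
    unfolding moduli_topology_def openin_quotient_topology
    by (simp only: openin_topspace order_refl simp_thms)
  then show "moduli_space d \<subseteq> topspace (moduli_topology d)"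
    by (rule openin_subset)
qed

text \<open>The preimage of a closed set in the parameter space is the zero locus of a family of
  polynomial functions, one of which does not vanish at a given point outside.\<close>

lemma separating_polynomial_fun:
  assumes C: "closedin (subtopology (moduli_topology d) S) C" and u: "u \<in> param_space d"
    and uC: "param_class d u \<in> S - C" and S: "S \<subseteq> topspace (moduli_topology d)"
  shows "\<exists>g. polynomial_fun {1..d} g \<and> g u \<noteq> 0 \<and>
    (\<forall>v\<in>param_space d. param_class d v \<in> C \<longrightarrow> g v = 0)"
proof -
  obtain D where D: "closedin (moduli_topology d) D" "C = D \<inter> S"
    using C by (auto simp: closedin_subtopology)
  let ?U = "topspace (moduli_topology d) - D"
  have "openin (moduli_topology d) ?U"
    using D by auto
  then have "openin (subtopology (zariski_topology {1..d}) (param_space d))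
      {v \<in> param_space d. param_class d v \<in> ?U}"
    unfolding moduli_topology_def openin_quotient_topology topspace_param_space by blast
  then obtain Q where Q: "\<forall>q\<in>Q. polynomial_fun {1..d} q"
    and eq: "{v \<in> param_space d. param_class d v \<in> ?U} =
      (affine_space {1..d} - zero_locus {1..d} Q) \<inter> param_space d"
    unfolding openin_subtopology openin_zariski_topology by auto
  have "u \<in> {v \<in> param_space d. param_class d v \<in> ?U}"
    using u uC D closedin_subset[OF C] S by auto
  then obtain g where g: "g \<in> Q" "g u \<noteq> 0"
    using eq u by (auto simp: zero_locus_def)
  moreover have "g v = 0" if v: "v \<in> param_space d" "param_class d v \<in> C" for v
  proof -
    have "v \<notin> (affine_space {1..d} - zero_locus {1..d} Q) \<inter> param_space d"
      using v D(2) eq by auto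
    then show ?thesis
      using v g by (auto simp: zero_locus_def param_space_def)
  qed
  ultimately show ?thesis
    using Q by blast
qed

theorem theorem1p3:
  fixes k p :: nat
  assumes "prime p" and "odd p"
  shows "irreducible_in (moduli_topology p) (preperiodic_locus k 1 p)"
proof -
  have p3: "3 \<le> p"
    using assms prime_ge_2_nat[OF assms(1)] by (cases "p = 2") auto
  let ?P = "preperiodic_locus k 1 p"
  note P = preperiodic_locus_eq_image[OF p3, of k]
  have sub: "?P \<subseteq> topspace (moduli_topology p)"
    unfolding topspace_moduli_topology[OF p3]
    by (auto simp: preperiodic_locus_def moduli_space_def intro: quotientI)
  then have top: "topspace (subtopology (moduli_topology p) ?P) = ?P"
    by auto
  have "C = ?P \<or> D = ?P"
    if C: "closedin (subtopology (moduli_topology p) ?P) C"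
      and D: "closedin (subtopology (moduli_topology p) ?P) D" and CD: "?P = C \<union> D" for C D
  proof (rule ccontr)
    assume "\<not> ?thesis"
    then obtain X Y where "X \<in> ?P - C" "Y \<in> ?P - D"
      using CD by blast
    then obtain u w where u: "u \<in> param_locus k p" "param_class p u \<in> ?P - C"
      and w: "w \<in> param_locus k p" "param_class p w \<in> ?P - D"
      unfolding P by blast
    then have uw: "u \<in> param_space p" "w \<in> param_space p"
      by (auto simp: param_locus_def)
    obtain g where g: "polynomial_fun {1..p} g" "g u \<noteq> 0"
      "\<forall>v\<in>param_space p. param_class p v \<in> C \<longrightarrow> g v = 0"
      using separating_polynomial_fun[OF C uw(1) u(2) sub] by blast
    obtain h where h: "polynomial_fun {1..p} h" "h w \<noteq> 0"
      "\<forall>v\<in>param_space p. param_class p v \<in> D \<longrightarrow> h v = 0"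
      using separating_polynomial_fun[OF D uw(2) w(2) sub] by blast
    have "g v = 0 \<or> h v = 0" if v: "v \<in> param_locus k p" for v
    proof -
      have "param_class p v \<in> C \<union> D"
        using v P CD by blast
      then show ?thesis
        using g(3) h(3) v by (auto simp: param_locus_def)
    qed
    then have "g u = 0 \<or> h w = 0"
      using param_locus_irreducible[OF assms g(1) h(1) _ u(1) w(1)] by blast
    with g(2) h(2) show False by simp
  qed
  moreover have "?P \<noteq> {}"
    unfolding P using param_locus_nonempty[OF assms] by simp
  ultimately show ?thesis
    unfolding irreducible_in_def irreducible_space_def top using sub by blast
qed

end
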